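(* Let $X$ be a separable rearrangement invariant space on $[0,1]$ of fundamental type, with lower and upper Boyd indices $\alpha_X$ and $\beta_X$. Then $$\mathcal{F}(X)=\mathcal{F}_c(X)=[1/\beta_X,\,1/\alpha_X].$$
   Context: Let $m$ be Lebesgue measure on $[0,1]$. A Banach function lattice on $[0,1]$ is a Banach space $E$ of (classes of) a.e. finite real measurable functions on $[0,1]$ such that $x\in E$, $y$ measurable, $|y|\le |x|$ a.e. imply $y\in E$ and $\|y\|_E\le\|x\|_E$. For measurable $f$, its right-continuous nonincreasing rearrangement is $f^*(t)=\inf\{\tau\ge 0: m\{s:|f(s)|>\tau\}\le t\}$. A rearrangement invariant (r.i.) space $X$ on $[0,1]$ is a Banach function lattice such that $f\in X$, $g$ measurable, $g^*\le f^*$ imply $g\in X$ and $\|g\|_X\le\|f\|_X$. Standing assumptions: an r.i. space is separable or has the Fatou property (if $x_n\in X$, $\sup_n\|x_n\|_X<\infty$, and $x_n\to x$ a.e., then $x\in X$ and $\|x\|_X\le\liminf_n\|x_n\|_X$), and $\|\chi_{[0,1]}\|_X=1$. Boyd indices. For $\tau>0$ let $\tilde\sigma_\tau x(t)=x(t/\tau)$ for $0\le t\le\min\{1,\tau\}$ and $\tilde\sigma_\tau x(t)=0$ for other $t\in[0,1]$; this operator is bounded in every r.i. space $X$ on $[0,1]$. Put $$\alpha_X=-\lim_{n\to\infty}\tfrac1n\log_2\|\tilde\sigma_{2^{-n}}\|_{X\to X},\qquad \beta_X=\lim_{n\to\infty}\tfrac1n\log_2\|\tilde\sigma_{2^{n}}\|_{X\to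 X}.$$ One has $0\le\alpha_X\le\beta_X\le1$. Convention: $1/0=\infty$, and intervals are subintervals of $[1,\infty]$ (so $\infty$ belongs to the interval when $\alpha_X=0$). Fundamental type. The fundamental function of $X$ is $\phi_X(t)=\|\chi_A\|_X$, where $m(A)=t$. For a positive function $\psi$ on $(0,1]$ put $\tilde M_\psi(t)=\sup_{0<s\le\min(1,1/t)}\psi(ts)/\psi(s)$, $\mu_\psi=-\lim_{n\to\infty}\frac1n\log_2\tilde M_\psi(2^{-n})$, $\nu_\psi=\lim_{n\to\infty}\frac1n\log_2\tilde M_\psi(2^{n})$. The space $X$ is of fundamental type if $\alpha_X=\mu_{\phi_X}$ and $\beta_X=\nu_{\phi_X}$. Symmetric finite representability. Functions $x,y$ are equimeasurable if $m\{|x|>\tau\}=m\{|y|>\tau\}$ for all $\tau>0$. For $a=(a_k)_{k=1}^n\in\mathbb R^n$, $\|a\|_p=(\sum_{k}|a_k|^p)^{1/p}$ if $1\le p<\infty$ and $\|a\|_\infty=\max_k|a_k|$. For $1\le p\le\infty$, $\ell^p$ is symmetrically finitely represented in $X$ if for every $n\in\mathbb N$ and $\varepsilon>0$ there exist pairwise equimeasurable functions $x_1,\dots,x_n\in X$ with pairwise disjoint supports such that $(1+\varepsilon)^{-1}\|a\|_p\le\|\sum_{k=1}^n a_kx_k\|_X\le(1+\varepsilon)\|a\|_p$ for all $a\in\mathbb R^n$. It is crudely symmetrically finitely represented in $X$ if there is a constant $C>0$ such that for every $n\in\mathbb N$ there exist pairwise equimeasurable functions $x_1,\dots,x_n\in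 X$ with pairwise disjoint supports such that $C^{-1}\|a\|_p\le\|\sum_{k=1}^n a_kx_k\|_X\le C\|a\|_p$ for all $a\in\mathbb R^n$. $\mathcal F(X)$ (resp. $\mathcal F_c(X)$) is the set of all $p\in[1,\infty]$ such that $\ell^p$ is symmetrically (resp. crudely symmetrically) finitely represented in $X$. *)

theory Defs
  imports "HOL-Analysis.Analysis"
begin

text \<open>
  Elements of a function space on \<open>[0,1]\<close> are represented by functions \<open>real \<Rightarrow> real\<close>, whose values
  outside \<open>[0,1]\<close> are irrelevant. A space of a.e. classes is given by the set \<open>X\<close> of all
  representatives and a seminorm \<open>N\<close> on them that vanishes exactly on the a.e. null functions;
  by the lattice axiom \<open>X\<close> and \<open>N\<close> are invariant under a.e. equality.
\<close>

abbreviation unit_leb :: "real measure" where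
  "unit_leb \<equiv> lebesgue_on {0..1}"

locale banach_function_lattice =
  fixes X :: "(real \<Rightarrow> real) set" and N :: "(real \<Rightarrow> real) \<Rightarrow> real"
  assumes measurable: "f \<in> X \<Longrightarrow> f \<in> borel_measurable unit_leb"
    and zero_mem: "(\<lambda>s. 0) \<in> X"
    and add_mem: "f \<in> X \<Longrightarrow> g \<in> X \<Longrightarrow> (\<lambda>s. f s + g s) \<in> X"
    and scale_mem: "f \<in> X \<Longrightarrow> (\<lambda>s. c * f s) \<in> X"
    and norm_nonneg: "f \<in> X \<Longrightarrow> 0 \<le> N f"
    and norm_eq_0_iff: "f \<in> X \<Longrightarrow> N f = 0 \<longleftrightarrow> (AE s in unit_leb. f s = 0)"
    and norm_triangle: "f \<in> X \<Longrightarrow> g \<in> X \<Longrightarrow> N (\<lambda>s. f s + g s) \<le> N f + N g"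
    and norm_scale: "f \<in> X \<Longrightarrow> N (\<lambda>s. c * f s) = \<bar>c\<bar> * N f"
    and complete: "(\<And>n. F n \<in> X) \<Longrightarrow>
       (\<And>e. e > 0 \<Longrightarrow> \<exists>n0::nat. \<forall>m\<ge>n0. \<forall>n\<ge>n0. N (\<lambda>s. F m s - F n s) < e) \<Longrightarrow>
       \<exists>f\<in>X. (\<lambda>n. N (\<lambda>s. F n s - f s)) \<longlonglongrightarrow> 0"
    and lattice: "f \<in> X \<Longrightarrow> g \<in> borel_measurable unit_leb \<Longrightarrow>
       (AE s in unit_leb. \<bar>g s\<bar> \<le> \<bar>f s\<bar>) \<Longrightarrow> g \<in> X \<and> N g \<le> N f"

definition distribution_fun :: "(real \<Rightarrow> real) \<Rightarrow> real \<Rightarrow> real" where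
  "distribution_fun f \<tau> = measure unit_leb {s \<in> {0..1}. \<bar>f s\<bar> > \<tau>}"

text \<open>Extended-real valued, since the value at \<open>0\<close> is \<open>\<infinity>\<close> for unbounded \<open>f\<close>.\<close>

definition rearrangement :: "(real \<Rightarrow> real) \<Rightarrow> real \<Rightarrow> ereal" where
  "rearrangement f t = Inf {ereal \<tau> | \<tau>. 0 \<le> \<tau> \<and> distribution_fun f \<tau> \<le> t}"

definition norm_separable :: "(real \<Rightarrow> real) set \<Rightarrow> ((real \<Rightarrow> real) \<Rightarrow> real) \<Rightarrow> bool" where
  "norm_separable X N \<longleftrightarrow>
     (\<exists>D\<subseteq>X. countable D \<and> (\<forall>f\<in>X. \<forall>e>0. \<exists>d\<in>D. N (\<lambda>s. f s - d s) < e))"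

definition fatou_property :: "(real \<Rightarrow> real) set \<Rightarrow> ((real \<Rightarrow> real) \<Rightarrow> real) \<Rightarrow> bool" where
  "fatou_property X N \<longleftrightarrow>
     (\<forall>F f. (\<forall>n::nat. F n \<in> X) \<longrightarrow> bdd_above (range (\<lambda>n. N (F n))) \<longrightarrow>
        f \<in> borel_measurable unit_leb \<longrightarrow> (AE s in unit_leb. (\<lambda>n. F n s) \<longlonglongrightarrow> f s) \<longrightarrow>
        f \<in> X \<and> ereal (N f) \<le> liminf (\<lambda>n. ereal (N (F n))))"

locale ri_space = banach_function_lattice +
  assumes rearrangement_invariant: "f \<in> X \<Longrightarrow> g \<in> borel_measurable unit_leb \<Longrightarrow>
       (\<And>t. t \<in> {0..1} \<Longrightarrow> rearrangement g t \<le> rearrangement f t) \<Longrightarrow> g \<in> X \<and> N g \<le> N f"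
    and separable_or_fatou: "norm_separable X N \<or> fatou_property X N"
    and unit_mem: "indicator {0..1} \<in> X"
    and norm_unit: "N (indicator {0..1}) = 1"

definition dilation :: "real \<Rightarrow> (real \<Rightarrow> real) \<Rightarrow> real \<Rightarrow> real" where
  "dilation \<tau> f t = (if 0 \<le> t \<and> t \<le> min 1 \<tau> then f (t / \<tau>) else 0)"

text \<open>
  The real suprema and limits below are genuine for r.i. spaces: \<open>dilation \<tau>\<close> is bounded,
  the quotients of the fundamental function are bounded, and the logarithms are subadditive in \<open>n\<close>.
\<close>

definition dilation_norm :: "(real \<Rightarrow> real) set \<Rightarrow> ((real \<Rightarrow> real) \<Rightarrow> real) \<Rightarrow> real \<Rightarrow> real" where
  "dilation_norm X N \<tau> = Sup {N (dilation \<tau> f) | f. f \<in> X \<and> N f \<le> 1}"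

definition lower_boyd :: "(real \<Rightarrow> real) set \<Rightarrow> ((real \<Rightarrow> real) \<Rightarrow> real) \<Rightarrow> real" where
  "lower_boyd X N = - lim (\<lambda>n::nat. 1 / real n * log 2 (dilation_norm X N (1 / 2 ^ n)))"

definition upper_boyd :: "(real \<Rightarrow> real) set \<Rightarrow> ((real \<Rightarrow> real) \<Rightarrow> real) \<Rightarrow> real" where
  "upper_boyd X N = lim (\<lambda>n::nat. 1 / real n * log 2 (dilation_norm X N (2 ^ n)))"

text \<open>The choice of the set of measure \<open>t\<close> is immaterial, as proved next.\<close>

definition fundamental_fun :: "((real \<Rightarrow> real) \<Rightarrow> real) \<Rightarrow> real \<Rightarrow> real" where
  "fundamental_fun N t = N (indicator {0..t})"

lemma (in ri_space) fundamental_fun_eq: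
  assumes A: "A \<in> sets unit_leb" and t: "measure unit_leb A = t"
  shows "N (indicator A) = fundamental_fun N t"
proof -
  have A1: "A \<subseteq> {0..1}" using A by (auto simp: sets_restrict_space)
  have "measure unit_leb A \<le> measure unit_leb {0..1}"
    by (rule finite_measure.finite_measure_mono)
       (use A A1 in \<open>auto simp: sets_restrict_space finite_measure_lebesgue_on\<close>)
  then have t01: "0 \<le> t" "t \<le> 1"
    using t measure_nonneg[of unit_leb A] by (auto simp: measure_restrict_space)
  have B: "{0..t} \<in> sets unit_leb" and B1: "{0..t} \<subseteq> {0..1}"
    using t01 by (auto simp: sets_restrict_space intro!: image_eqI[where x="{0..t}"])
  have Bt: "measure unit_leb {0..t} = t"
    using t01 B1 by (simp add: measure_restrict_space)
  have mem: "indicator C \<in> borel_measurable unit_leb \<and> indicator C \<in> X"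
    if C: "C \<in> sets unit_leb" for C
  proof -
    have m: "indicator C \<in> borel_measurable unit_leb" using C by simp
    have "AE s in unit_leb. \<bar>indicator C s :: real\<bar> \<le> \<bar>indicator {0..1} s\<bar>"
      by (rule AE_I2) (auto simp: indicator_def)
    then show ?thesis using lattice[OF unit_mem m] m by blast
  qed
  have d: "distribution_fun (indicator C) \<tau> = (if \<tau> < 1 then t else 0)"
    if "C \<subseteq> {0..1}" "measure unit_leb C = t" "0 \<le> \<tau>" for C \<tau>
  proof -
    have "{s \<in> {0..1}. \<bar>indicator C s :: real\<bar> > \<tau>} = (if \<tau> < 1 then C else {})"
      using that by (auto simp: indicator_def split: if_splits)
    then show ?thesis using that by (simp add: distribution_fun_def)
  qed
  have r: "rearrangement (indicator A) u = rearrangement (indicator {0..t}) u" for u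
    unfolding rearrangement_def using d[OF A1 t] d[OF B1 Bt]
    by (intro arg_cong[where f=Inf]) auto
  show ?thesis unfolding fundamental_fun_def
    using rearrangement_invariant[of "indicator A" "indicator {0..t}"]
      rearrangement_invariant[of "indicator {0..t}" "indicator A"] mem[OF A] mem[OF B] r
    by (auto intro!: antisym)
qed

definition dilation_fun :: "(real \<Rightarrow> real) \<Rightarrow> real \<Rightarrow> real" where
  "dilation_fun \<psi> t = Sup {\<psi> (t * s) / \<psi> s | s. 0 < s \<and> s \<le> min 1 (1 / t)}"

definition lower_dilation_index :: "(real \<Rightarrow> real) \<Rightarrow> real" where
  "lower_dilation_index \<psi> = - lim (\<lambda>n::nat. 1 / real n * log 2 (dilation_fun \<psi> (1 / 2 ^ n)))"

definition upper_dilation_index :: "(real \<Rightarrow> real) \<Rightarrow> real" where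
  "upper_dilation_index \<psi> = lim (\<lambda>n::nat. 1 / real n * log 2 (dilation_fun \<psi> (2 ^ n)))"

definition fundamental_type :: "(real \<Rightarrow> real) set \<Rightarrow> ((real \<Rightarrow> real) \<Rightarrow> real) \<Rightarrow> bool" where
  "fundamental_type X N \<longleftrightarrow>
     lower_boyd X N = lower_dilation_index (fundamental_fun N) \<and>
     upper_boyd X N = upper_dilation_index (fundamental_fun N)"

definition equimeasurable :: "(real \<Rightarrow> real) \<Rightarrow> (real \<Rightarrow> real) \<Rightarrow> bool" where
  "equimeasurable f g \<longleftrightarrow> (\<forall>\<tau>>0. distribution_fun f \<tau> = distribution_fun g \<tau>)"

definition lp_norm :: "ereal \<Rightarrow> nat \<Rightarrow> (nat \<Rightarrow> real) \<Rightarrow> real" where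
  "lp_norm p n a =
     (if p = \<infinity> then Max ((\<lambda>k. \<bar>a k\<bar>) ` {1..n})
      else (\<Sum>k=1..n. \<bar>a k\<bar> powr real_of_ereal p) powr (1 / real_of_ereal p))"

text \<open>Disjointness of supports is meant a.e., as befits classes of functions.\<close>

definition symmetric_system :: "(real \<Rightarrow> real) set \<Rightarrow> nat \<Rightarrow> (nat \<Rightarrow> real \<Rightarrow> real) \<Rightarrow> bool" where
  "symmetric_system X n x \<longleftrightarrow>
     (\<forall>i\<in>{1..n}. x i \<in> X) \<and>
     (\<forall>i\<in>{1..n}. \<forall>j\<in>{1..n}. equimeasurable (x i) (x j)) \<and>
     (\<forall>i\<in>{1..n}. \<forall>j\<in>{1..n}. i \<noteq> j \<longrightarrow> (AE s in unit_leb. x i s = 0 \<or> x j s = 0))"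

definition lp_equivalent ::
  "((real \<Rightarrow> real) \<Rightarrow> real) \<Rightarrow> ereal \<Rightarrow> real \<Rightarrow> nat \<Rightarrow> (nat \<Rightarrow> real \<Rightarrow> real) \<Rightarrow> bool" where
  "lp_equivalent N p C n x \<longleftrightarrow>
     (\<forall>a. inverse C * lp_norm p n a \<le> N (\<lambda>s. \<Sum>k=1..n. a k * x k s) \<and>
          N (\<lambda>s. \<Sum>k=1..n. a k * x k s) \<le> C * lp_norm p n a)"

definition sym_fin_rep :: "(real \<Rightarrow> real) set \<Rightarrow> ((real \<Rightarrow> real) \<Rightarrow> real) \<Rightarrow> ereal \<Rightarrow> bool" where
  "sym_fin_rep X N p \<longleftrightarrow>
     (\<forall>n\<ge>1. \<forall>\<epsilon>>0. \<exists>x. symmetric_system X n x \<and> lp_equivalent N p (1 + \<epsilon>) n x)"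

definition crude_sym_fin_rep :: "(real \<Rightarrow> real) set \<Rightarrow> ((real \<Rightarrow> real) \<Rightarrow> real) \<Rightarrow> ereal \<Rightarrow> bool" where
  "crude_sym_fin_rep X N p \<longleftrightarrow>
     (\<exists>C>0. \<forall>n\<ge>1. \<exists>x. symmetric_system X n x \<and> lp_equivalent N p C n x)"

text \<open>
  The exponents live in \<open>[1,\<infinity>]\<close> as a subset of the extended reals, where \<open>1 / 0 = \<infinity>\<close>.
\<close>

definition sym_fin_rep_set :: "(real \<Rightarrow> real) set \<Rightarrow> ((real \<Rightarrow> real) \<Rightarrow> real) \<Rightarrow> ereal set" where
  "sym_fin_rep_set X N = {p. 1 \<le> p \<and> sym_fin_rep X N p}"

definition crude_sym_fin_rep_set :: "(real \<Rightarrow> real) set \<Rightarrow> ((real \<Rightarrow> real) \<Rightarrow> real) \<Rightarrow> ereal set" where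
  "crude_sym_fin_rep_set X N = {p. 1 \<le> p \<and> crude_sym_fin_rep X N p}"

end

theory Submission imports Defs begin

text \<open>
  Necessity of the index bounds: if \<open>n\<close> disjoint equimeasurable functions behave like the unit
  vectors of \<open>\<ell>\<^sup>p\<close>, their sum \<open>S\<close> has norm about \<open>n powr (1/p)\<close>, while its compression into \<open>[0, 1/n]\<close> is equimeasurable with one of them and has
  norm about \<open>1\<close>. Hence the dilations of factor \<open>n\<close> and \<open>1/n\<close> have norms of at least the orders
  \<open>n powr (1/p)\<close> and \<open>n powr (-1/p)\<close> (\<open>lp_equivalent_dilation_norms\<close>). With \<open>n = 2 ^ m\<close> this
  places \<open>1/p\<close> between the Boyd indices; that these are limits at all is Fekete's lemma
  (\<open>subadditive_limit\<close>).

  Sufficiency for \<open>p = \<infinity>\<close>: a vanishing lower Boyd index means that contractions have norm \<open>1\<close>,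
  and disjoint copies of a contraction of an almost extremal function behave like unit vectors
  of \<open>\<ell>\<^sup>\<infinity>\<close> (\<open>sym_fin_rep_infinity\<close>).

  Sufficiency for \<open>p < \<infinity>\<close> rests on the function \<open>t powr (-\<theta>)\<close> with \<open>\<theta> = 1/p\<close>. Its
  multiple by \<open>a > 0\<close> exceeds a level on a set whose measure is \<open>a powr p\<close> times that for the
  function itself. Therefore, if the numbers \<open>\<bar>a k\<bar> powr p\<close> add up to \<open>1\<close>, a combination with
  coefficients \<open>a k\<close> of disjoint copies has the same distribution as the function itself. To stay
  in the unit interval and in the space, the function is restricted to a window \<open>(1/2^B, 1/2^A]\<close>, and all the error comes from the
  edges of the window. The strips at the edges have norms of the order of \<open>\<phi> t * t powr (-\<theta>)\<close> at
  \<open>t = 1/2^A\<close> and \<open>t = 1/2^B\<close>, where \<open>\<phi>\<close> is the fundamental function. So these products must be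
  much smaller than at some point inside the window.

  Here the fundamental type enters. The Boyd indices equal the dilation indices of \<open>\<phi>\<close>, so for
  \<open>\<theta>\<close> between them there are arbitrarily long stretches of \<open>\<phi>\<close> with decay not faster than
  exponent \<open>\<theta>\<close> and others with decay not slower than exponent \<open>\<theta>\<close> (\<open>lower_dilation_window\<close>,
  \<open>upper_dilation_window\<close>), and the second kind can be found closer to \<open>0\<close> than the first
  (\<open>separating_windows\<close>). Bending the exponent of the power function by a small \<open>\<delta>\<close> between two
  such stretches makes the product with \<open>\<phi>\<close> grow along the first stretch and decrease along the
  second. This covers the case that \<open>\<theta>\<close> equals one of the indices as well. The bent power
  function is homogeneous only up to the exponent \<open>\<delta>\<close>, which is harmless for coefficients bounded away from \<open>0\<close>; the others
  are negligible (\<open>combination_norm\<close>, \<open>copies_almost_isometric\<close>).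
\<close>

section \<open>Distribution functions\<close>

lemma finite_measure_unit_leb: "finite_measure unit_leb"
  by (rule finite_measure_lebesgue_on) simp

lemma level_set_measurable:
  fixes f :: "real \<Rightarrow> real"
  assumes [measurable]: "f \<in> borel_measurable unit_leb"
  shows "{s \<in> {0..1}. \<bar>f s\<bar> > \<tau>} \<in> sets unit_leb"
proof -
  have "{s \<in> space unit_leb. \<bar>f s\<bar> > \<tau>} \<in> sets unit_leb"
    by measurable
  then show ?thesis by simp
qed

text \<open>The point \<open>0\<close> is dropped so that half-open intervals partition the domain exactly.\<close>

lemma distribution_fun_half_open:
  "distribution_fun f \<tau> = measure lebesgue {s \<in> {0<..1}. \<bar>f s\<bar> > \<tau>}"
proof -
  have "distribution_fun f \<tau> = measure lebesgue {s \<in> {0..1}. \<bar>f s\<bar> > \<tau>}"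
    unfolding distribution_fun_def by (rule measure_restrict_space) auto
  also have "\<dots> = measure lebesgue {s \<in> {0<..1}. \<bar>f s\<bar> > \<tau>}"
  proof (cases "{s \<in> {0..1}. \<bar>f s\<bar> > \<tau>} \<in> sets lebesgue")
    case True
    have "{s \<in> {0<..1}. \<bar>f s\<bar> > \<tau>} = {s \<in> {0..1}. \<bar>f s\<bar> > \<tau>} - {0}"
      by auto
    moreover have "measure lebesgue ({s \<in> {0..1}. \<bar>f s\<bar> > \<tau>} - {0}) = measure lebesgue {s \<in> {0..1}. \<bar>f s\<bar> > \<tau>}"
      by (rule measure_Diff_null_set) (use True in auto)
    ultimately show ?thesis by simp
  next
    case False
    have "{s \<in> {0<..1}. \<bar>f s\<bar> > \<tau>} \<notin> sets lebesgue"
    proof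
      assume *: "{s \<in> {0<..1}. \<bar>f s\<bar> > \<tau>} \<in> sets lebesgue"
      have "{s \<in> {0..1}. \<bar>f s\<bar> > \<tau>} = {s \<in> {0<..1}. \<bar>f s\<bar> > \<tau>} \<union> (if \<bar>f 0\<bar> > \<tau> then {0} else {})"
        by (auto simp: less_eq_real_def split: if_splits)
      moreover have "\<dots> \<in> sets lebesgue" using * by (intro sets.Un) auto
      ultimately show False using False by simp
    qed
    then show ?thesis using False by (simp add: measure_notin_sets)
  qed
  finally show ?thesis .
qed

lemma distribution_fun_nonneg: "0 \<le> distribution_fun f \<tau>"
  by (simp add: distribution_fun_def)

lemma distribution_fun_cong:
  assumes "\<And>s. 0 < s \<Longrightarrow> s \<le> 1 \<Longrightarrow> \<bar>f s\<bar> = \<bar>g s\<bar>"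
  shows "distribution_fun f \<tau> = distribution_fun g \<tau>"
proof -
  have "{s \<in> {0<..1}. \<bar>f s\<bar> > \<tau>} = {s \<in> {0<..1}. \<bar>g s\<bar> > \<tau>}" using assms by auto
  then show ?thesis by (simp add: distribution_fun_half_open)
qed

lemma distribution_fun_mono:
  assumes f: "f \<in> borel_measurable unit_leb"
    and le: "AE s in unit_leb. \<bar>g s\<bar> \<le> \<bar>f s\<bar>"
  shows "distribution_fun g \<tau> \<le> distribution_fun f \<tau>"
proof -
  interpret finite_measure unit_leb by (rule finite_measure_unit_leb)
  show ?thesis unfolding distribution_fun_def
    by (rule finite_measure_mono_AE) (use le level_set_measurable[OF f] in auto)
qed

text \<open>At almost every point at most one summand is nonzero, so the indicators of the level sets
  add up as well.\<close>

lemma distribution_fun_sum_disjoint: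
  assumes fin: "finite I" and x: "\<And>i. i \<in> I \<Longrightarrow> x i \<in> borel_measurable unit_leb"
    and disj: "\<And>i j. i \<in> I \<Longrightarrow> j \<in> I \<Longrightarrow> i \<noteq> j \<Longrightarrow> AE s in unit_leb. x i s = 0 \<or> x j s = 0"
    and \<tau>: "0 \<le> \<tau>"
  shows "distribution_fun (\<lambda>s. \<Sum>i\<in>I. x i s) \<tau> = (\<Sum>i\<in>I. distribution_fun (x i) \<tau>)"
proof -
  interpret finite_measure unit_leb by (rule finite_measure_unit_leb)
  let ?L = "\<lambda>f. {s \<in> {0..1}. \<bar>f s\<bar> > \<tau>}"
  let ?S = "\<lambda>s. \<Sum>i\<in>I. x i s"
  have d: "distribution_fun f \<tau> = (\<integral>s. indicator (?L f) s \<partial>unit_leb)" 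
    "integrable unit_leb (indicator (?L f) :: real \<Rightarrow> real)"
    if "f \<in> borel_measurable unit_leb" for f
  proof -
    have L: "?L f \<in> sets unit_leb" by (rule level_set_measurable[OF that])
    show "distribution_fun f \<tau> = (\<integral>s. indicator (?L f) s \<partial>unit_leb)"
      using L unfolding distribution_fun_def
      by (subst Bochner_Integration.integral_indicator)
         (auto intro!: arg_cong[where f="measure unit_leb"])
    show "integrable unit_leb (indicator (?L f) :: real \<Rightarrow> real)"
      using L by (intro integrable_real_indicator) (simp_all add: less_top[symmetric])
  qed
  have Sm: "?S \<in> borel_measurable unit_leb" using x by measurable
  have "AE s in unit_leb. \<forall>p \<in> {(i,j). i \<in> I \<and> j \<in> I \<and> i \<noteq> j}. x (fst p) s = 0 \<or> x (snd p) s = 0"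
    by (rule AE_finite_allI)
       (use fin disj in \<open>auto intro: finite_subset[of _ "I \<times> I"]\<close>)
  then have AE: "AE s in unit_leb. indicator (?L ?S) s = (\<Sum>i\<in>I. indicator (?L (x i)) s :: real)"
  proof eventually_elim
    case (elim s)
    show ?case
    proof (cases "\<exists>k\<in>I. x k s \<noteq> 0")
      case True
      then obtain k where k: "k \<in> I" "x k s \<noteq> 0" by blast
      have z: "x i s = 0" if "i \<in> I" "i \<noteq> k" for i using elim that k by force
      have "?S s = x k s" using fin k z by (subst sum.remove[of _ k]) auto
      moreover have "(\<Sum>i\<in>I. indicator (?L (x i)) s :: real) = indicator (?L (x k)) s"
        using fin k z \<tau> by (subst sum.remove[of _ k]) (auto simp: indicator_def)
      ultimately show ?thesis by (simp add: indicator_def)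
    next
      case False
      then show ?thesis using \<tau> by (simp add: indicator_def)
    qed
  qed
  have "distribution_fun ?S \<tau> = (\<integral>s. (\<Sum>i\<in>I. indicator (?L (x i)) s) \<partial>unit_leb)"
    unfolding d(1)[OF Sm]
    by (rule integral_cong_AE)
       (use AE Sm x level_set_measurable in \<open>auto intro!: borel_measurable_sum borel_measurable_indicator\<close>)
  also have "\<dots> = (\<Sum>i\<in>I. distribution_fun (x i) \<tau>)"
    using d x by (subst Bochner_Integration.integral_sum) auto
  finally show ?thesis .
qed

lemma measurable_affine_unit_leb:
  fixes f :: "real \<Rightarrow> real"
  assumes f: "f \<in> borel_measurable unit_leb" and c: "c \<noteq> 0" and S: "S \<in> sets lebesgue"
    and sub: "\<And>t. t \<in> S \<Longrightarrow> c * t + d \<in> {0..1}"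
  shows "(\<lambda>t. if t \<in> S then f (c * t + d) else 0) \<in> borel_measurable unit_leb"
proof -
  let ?f = "\<lambda>s. if s \<in> {0..1} then f s else 0"
  have 1: "?f \<in> borel_measurable lebesgue" by (rule borel_measurable_if_I[OF f]) simp
  have 2: "(\<lambda>t. c * t + d) \<in> lebesgue \<rightarrow>\<^sub>M lebesgue"
    using lebesgue_affine_measurable[where c="\<lambda>_::real. c" and t=d] c by (simp add: add.commute)
  have "(\<lambda>t. ?f (c * t + d)) \<in> borel_measurable lebesgue"
    using measurable_compose[OF 2 1] by simp
  then have "(\<lambda>t. indicator S t *\<^sub>R ?f (c * t + d)) \<in> borel_measurable lebesgue"
    using S by (intro borel_measurable_scaleR borel_measurable_indicator) auto
  moreover have "(\<lambda>t. indicator S t *\<^sub>R ?f (c * t + d)) = (\<lambda>t. if t \<in> S then f (c * t + d) else 0)"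
    using sub by (auto simp: indicator_def)
  ultimately show ?thesis by (simp add: measurable_restrict_space1)
qed

text \<open>A copy of \<open>f\<close> compressed into the interval \<open>(d, d + c]\<close>.\<close>

definition squeeze :: "real \<Rightarrow> real \<Rightarrow> (real \<Rightarrow> real) \<Rightarrow> real \<Rightarrow> real" where
  "squeeze c d f t = (if d < t \<and> t \<le> d + c then f ((t - d) / c) else 0)"

lemma squeeze_measurable:
  assumes f: "f \<in> borel_measurable unit_leb" and c: "0 < c"
  shows "squeeze c d f \<in> borel_measurable unit_leb"
proof -
  have "(\<lambda>t. if t \<in> {d<..d + c} then f (1 / c * t + (- d / c)) else 0) \<in> borel_measurable unit_leb"
    by (rule measurable_affine_unit_leb[OF f])
       (use c in \<open>auto simp: field_simps\<close>)
  also have "(\<lambda>t. if t \<in> {d<..d + c} then f (1 / c * t + (- d / c)) else 0) = squeeze c d f"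
    by (auto simp: squeeze_def fun_eq_iff diff_divide_distrib)
  finally show ?thesis .
qed

lemma distribution_fun_squeeze:
  assumes c: "0 < c" and d: "0 \<le> d" "d + c \<le> 1" and \<tau>: "0 \<le> \<tau>"
  shows "distribution_fun (squeeze c d f) \<tau> = c * distribution_fun f \<tau>"
proof -
  have "{t \<in> {0<..1}. \<bar>squeeze c d f t\<bar> > \<tau>} = (\<lambda>s. c *\<^sub>R s + d) ` {s \<in> {0<..1}. \<bar>f s\<bar> > \<tau>}"
    (is "?A = ?B")
  proof (intro equalityI subsetI)
    fix t assume "t \<in> ?A"
    then have t: "d < t" "t \<le> d + c" "\<bar>f ((t - d) / c)\<bar> > \<tau>"
      using \<tau> by (auto simp: squeeze_def split: if_splits)
    then show "t \<in> ?B" using c by (intro image_eqI[where x="(t - d) / c"]) (auto simp: field_simps)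
  next
    fix t assume "t \<in> ?B"
    then obtain s where s: "t = c * s + d" "0 < s" "s \<le> 1" "\<bar>f s\<bar> > \<tau>" by auto
    have *: "0 < c * s" "c * s \<le> c" using s c by (auto simp: mult_left_le)
    then have "d < t" "t \<le> d + c" "0 < t" "t \<le> 1" using s(1) d by linarith+
    moreover have "(t - d) / c = s" using s(1) c by simp
    ultimately show "t \<in> ?A" using s(4) by (simp add: squeeze_def)
  qed
  then show ?thesis
    using measure_lebesgue_affine[of c d "{s \<in> {0<..1}. \<bar>f s\<bar> > \<tau>}"] c
    by (simp add: distribution_fun_half_open)
qed

lemma grid_interval_unique:
  fixes c s :: real
  assumes "real i * c < s" "s \<le> real i * c + c" "real j * c < s" "s \<le> real j * c + c"
  shows "i = j"
proof -
  have c: "0 < c" using assms by linarith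
  have "real i * c < real (Suc j) * c" "real j * c < real (Suc i) * c"
    using assms by (auto simp: algebra_simps)
  then have "i < Suc j" "j < Suc i" using c by (auto simp: mult_less_cancel_right)
  then show ?thesis by simp
qed

lemma squeeze_disjoint:
  assumes "i \<noteq> j"
  shows "squeeze c (real i * c) f s = 0 \<or> squeeze c (real j * c) g s = 0"
  using grid_interval_unique[of i c s j] assms by (auto simp: squeeze_def)

text \<open>Positive levels suffice, since the infimum that defines the rearrangement can be approached
  from above.\<close>

lemma rearrangement_mono:
  assumes f: "f \<in> borel_measurable unit_leb"
    and le: "\<And>\<tau>. \<tau> > 0 \<Longrightarrow> distribution_fun g \<tau> \<le> distribution_fun f \<tau>"
  shows "rearrangement g t \<le> rearrangement f t"
  unfolding rearrangement_def
proof (rule Inf_greatest)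
  fix z assume "z \<in> {ereal \<tau> |\<tau>. 0 \<le> \<tau> \<and> distribution_fun f \<tau> \<le> t}"
  then obtain \<tau> where \<tau>: "z = ereal \<tau>" "0 \<le> \<tau>" "distribution_fun f \<tau> \<le> t" by blast
  interpret finite_measure unit_leb by (rule finite_measure_unit_leb)
  show "Inf {ereal \<tau> |\<tau>. 0 \<le> \<tau> \<and> distribution_fun g \<tau> \<le> t} \<le> z"
  proof (rule ereal_le_epsilon2)
    fix e :: real assume e: "0 < e"
    have "distribution_fun g (\<tau> + e) \<le> distribution_fun f (\<tau> + e)" using le e \<tau> by simp
    also have "\<dots> \<le> distribution_fun f \<tau>"
      unfolding distribution_fun_def
      by (rule finite_measure_mono) (use e level_set_measurable[OF f] in auto)
    finally have "distribution_fun g (\<tau> + e) \<le> t" using \<tau> by simp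
    then show "Inf {ereal \<tau> |\<tau>. 0 \<le> \<tau> \<and> distribution_fun g \<tau> \<le> t} \<le> z + ereal e"
      using e \<tau> by (intro Inf_lower) auto
  qed
qed

section \<open>Submultiplicative sequences\<close>

text \<open>Fekete's lemma. Division with remainder \<open>n = q m + r\<close> bounds \<open>u n / n\<close> by
  \<open>u m / m\<close> up to an error of order \<open>1 / n\<close>, so no value \<open>u m / m\<close> lies below the limit.\<close>

lemma subadditive_limit:
  fixes u :: "nat \<Rightarrow> real"
  assumes sub: "\<And>m n. u (m + n) \<le> u m + u n" and low: "\<And>n. - K * real n \<le> u n"
  obtains L where "(\<lambda>n. u n / real n) \<longlonglongrightarrow> L" "\<And>n. 1 \<le> n \<Longrightarrow> L \<le> u n / real n"
proof
  let ?Q = "{u n / real n | n. 1 \<le> n}"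
  let ?L = "Inf ?Q"
  have bdd: "bdd_below ?Q"
    by (rule bdd_belowI[where m="- K"]) (use low in \<open>auto simp: field_simps\<close>)
  show L: "?L \<le> u n / real n" if "1 \<le> n" for n
    by (rule cInf_lower[OF _ bdd]) (use that in auto)
  show "(\<lambda>n. u n / real n) \<longlonglongrightarrow> ?L"
  proof (rule LIMSEQ_I)
    fix e :: real assume e: "0 < e"
    have "?Q \<noteq> {}" by auto
    then obtain m where m: "1 \<le> m" "u m / real m < ?L + e / 2"
      using cInf_lessD[of ?Q "?L + e / 2"] e by auto
    define M where "M = \<bar>u m\<bar> + (\<Sum>r<m. \<bar>u r\<bar>)"
    have ind: "u (q * m + r) \<le> real q * u m + u r" for q r
    proof (induction q)
      case (Suc q)
      have "u (Suc q * m + r) \<le> u m + u (q * m + r)"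
        using sub[of m "q * m + r"] by (simp add: add.assoc)
      then show ?case using Suc by (simp add: algebra_simps)
    qed simp
    have upper: "u n / real n \<le> u m / real m + M / real n" if n: "1 \<le> n" for n
    proof -
      define q r where "q = n div m" and "r = n mod m"
      have nqr: "n = q * m + r" and r: "r < m" using m by (simp_all add: q_def r_def)
      have "\<bar>u r\<bar> \<le> (\<Sum>r<m. \<bar>u r\<bar>)" by (rule member_le_sum) (use r in auto)
      moreover have "\<bar>real r / real m * u m\<bar> \<le> \<bar>u m\<bar>"
      proof -
        have "real r / real m * \<bar>u m\<bar> \<le> 1 * \<bar>u m\<bar>" using r by (intro mult_right_mono) auto
        then show ?thesis by (simp add: abs_mult)
      qed
      moreover have "real q * u m = real n * (u m / real m) - real r / real m * u m"
        using m by (simp add: nqr field_simps)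
      ultimately have "u n \<le> real n * (u m / real m) + M"
        using ind[of q r] unfolding nqr[symmetric] M_def by linarith
      then show ?thesis using n by (simp add: field_simps)
    qed
    obtain n0 :: nat where n0: "2 * M / e < real n0" using reals_Archimedean2 by blast
    show "\<exists>n0. \<forall>n\<ge>n0. norm (u n / real n - ?L) < e"
    proof (intro exI allI impI)
      fix n assume n: "max 1 n0 \<le> n"
      then have "2 * M / e < real n" "0 < real n" using n0 by (auto simp: max_def split: if_splits)
      then have "M / real n < e / 2" using e by (simp add: field_simps)
      then have "u n / real n < ?L + e" using upper[of n] n m by linarith
      then show "norm (u n / real n - ?L) < e" using L[of n] n by (simp add: abs_if)
    qed
  qed
qed

lemma submultiplicative_growth:
  fixes h :: "nat \<Rightarrow> real"
  assumes sub: "\<And>m n. h (m + n) \<le> h m * h n" and low: "\<And>n. 1 / 2 ^ n \<le> h n"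
  defines "L \<equiv> lim (\<lambda>n. 1 / real n * log 2 (h n))"
  shows "(\<lambda>n. 1 / real n * log 2 (h n)) \<longlonglongrightarrow> L" and "2 powr (L * real n) \<le> h n"
proof -
  have pos: "0 < h n" for n using low[of n] by (rule less_le_trans[rotated]) simp
  have A: "log 2 (h (m + n)) \<le> log 2 (h m) + log 2 (h n)" for m n
  proof -
    have "log 2 (h (m + n)) \<le> log 2 (h m * h n)" using sub[of m n] pos by simp
    also have "\<dots> = log 2 (h m) + log 2 (h n)" using pos[of m] pos[of n] by (simp add: log_mult)
    finally show ?thesis .
  qed
  have B: "- 1 * real n \<le> log 2 (h n)" for n
  proof -
    have "log 2 (1 / 2 ^ n) \<le> log 2 (h n)" using low[of n] pos[of n] by simp
    then show ?thesis by (simp add: log_divide log_nat_power)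
  qed
  obtain L' where L': "(\<lambda>n. log 2 (h n) / real n) \<longlonglongrightarrow> L'"
    and le: "\<And>n. 1 \<le> n \<Longrightarrow> L' \<le> log 2 (h n) / real n"
    using subadditive_limit[OF A B] by blast
  have eq: "L = L'" using L' by (auto simp: L_def intro!: limI)
  show "(\<lambda>n. 1 / real n * log 2 (h n)) \<longlonglongrightarrow> L" using L' by (simp add: eq)
  show "2 powr (L * real n) \<le> h n"
  proof (cases "n = 0")
    case True
    then show ?thesis using low[of 0] by simp
  next
    case False
    then have "L * real n \<le> log 2 (h n)" using le[of n] by (simp add: eq field_simps)
    then show ?thesis using pos[of n] by (simp add: le_log_iff)
  qed
qed

section \<open>Norm estimates through distributions\<close>

context ri_space
begin

lemma norm_le_of_distribution:
  assumes f: "f \<in> X" and g: "g \<in> borel_measurable unit_leb"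
    and le: "\<And>\<tau>. \<tau> > 0 \<Longrightarrow> distribution_fun g \<tau> \<le> distribution_fun f \<tau>"
  shows "g \<in> X" "N g \<le> N f"
  using rearrangement_invariant[OF f g rearrangement_mono[OF measurable[OF f] le]] by auto

lemma norm_eq_of_distribution:
  assumes f: "f \<in> X" and g: "g \<in> borel_measurable unit_leb"
    and eq: "\<And>\<tau>. \<tau> > 0 \<Longrightarrow> distribution_fun g \<tau> = distribution_fun f \<tau>"
  shows "g \<in> X" "N g = N f"
proof -
  show "g \<in> X" using norm_le_of_distribution[OF f g] eq by simp
  then show "N g = N f"
    using norm_le_of_distribution[OF f g] norm_le_of_distribution[OF _ measurable[OF f], of g] eq
    by (simp add: antisym)
qed

lemma norm_mono:
  assumes "f \<in> X" "g \<in> borel_measurable unit_leb" "\<And>s. s \<in> {0..1} \<Longrightarrow> \<bar>g s\<bar> \<le> \<bar>f s\<bar>"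
  shows "g \<in> X" "N g \<le> N f"
proof -
  have "AE s in unit_leb. \<bar>g s\<bar> \<le> \<bar>f s\<bar>" by (rule AE_I2) (use assms(3) in simp)
  then show "g \<in> X" "N g \<le> N f" using lattice[OF assms(1,2)] by auto
qed

lemma sum_mem_norm:
  assumes "finite I" "\<And>i. i \<in> I \<Longrightarrow> x i \<in> X"
  shows "(\<lambda>s. \<Sum>i\<in>I. x i s) \<in> X \<and> N (\<lambda>s. \<Sum>i\<in>I. x i s) \<le> (\<Sum>i\<in>I. N (x i))"
  using assms
proof (induction I rule: finite_induct)
  case empty
  then show ?case using zero_mem norm_eq_0_iff[OF zero_mem] by simp
next
  case (insert i I)
  then show ?case
    using add_mem[of "x i" "\<lambda>s. \<Sum>i\<in>I. x i s"] norm_triangle[of "x i" "\<lambda>s. \<Sum>i\<in>I. x i s"] by force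
qed

lemma norm_pos:
  assumes f: "f \<in> X" and \<tau>: "0 \<le> \<tau>" and d: "0 < distribution_fun f \<tau>"
  shows "0 < N f"
proof (rule ccontr)
  assume "\<not> 0 < N f"
  then have "AE s in unit_leb. f s = 0" using norm_nonneg[OF f] norm_eq_0_iff[OF f] by simp
  then have "distribution_fun f \<tau> \<le> distribution_fun (\<lambda>s. 0) \<tau>"
    by (intro distribution_fun_mono) auto
  then show False using d \<tau> by (simp add: distribution_fun_def)
qed

lemma squeeze_mem:
  assumes f: "f \<in> X" and c: "0 < c" "0 \<le> d" "d + c \<le> 1"
  shows "squeeze c d f \<in> X" "N (squeeze c d f) = N (squeeze c 0 f)" "N (squeeze c d f) \<le> N f"
proof -
  note m = squeeze_measurable[OF measurable[OF f] c(1)]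
  have le: "distribution_fun (squeeze c d f) \<tau> \<le> distribution_fun f \<tau>"
    if "d + c \<le> 1" "0 \<le> d" "\<tau> > 0" for d \<tau>
    using that c mult_left_le_one_le[OF distribution_fun_nonneg[of f \<tau>], of c]
    by (simp add: distribution_fun_squeeze)
  show "squeeze c d f \<in> X" "N (squeeze c d f) \<le> N f"
    using norm_le_of_distribution[OF f m[of d] le] c by auto
  have "squeeze c 0 f \<in> X"
    using norm_le_of_distribution[OF f m[of 0] le] c by auto
  then show "N (squeeze c d f) = N (squeeze c 0 f)"
    by (rule norm_eq_of_distribution[OF _ m]) (use c in \<open>simp add: distribution_fun_squeeze\<close>)
qed

text \<open>\<open>F\<close> is equimeasurable with the sum of \<open>m\<close> disjoint copies of its compression into
  \<open>(0, 1/m]\<close>.\<close>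

lemma norm_le_squeeze:
  assumes F: "F \<in> borel_measurable unit_leb" and m: "1 \<le> m"
    and sq: "squeeze (1 / real m) 0 F \<in> X"
  shows "F \<in> X" "N F \<le> real m * N (squeeze (1 / real m) 0 F)"
proof -
  let ?c = "1 / real m"
  let ?x = "\<lambda>k. squeeze ?c (real k * ?c) F"
  have c: "0 < ?c" using m by simp
  have kc: "0 \<le> real k * ?c" "real k * ?c + ?c \<le> 1" if "k < m" for k
  proof -
    have "real (Suc k) * ?c \<le> 1" using that m by (simp add: field_simps)
    then show "real k * ?c + ?c \<le> 1" by (simp add: add_divide_distrib)
  qed simp
  have xm: "?x k \<in> borel_measurable unit_leb" for k by (rule squeeze_measurable[OF F c])
  have x: "?x k \<in> X" "N (?x k) = N (squeeze ?c 0 F)" if "k < m" for k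
    using norm_eq_of_distribution[OF sq xm, of k] kc[OF that] c m
    by (auto simp: distribution_fun_squeeze)
  let ?S = "\<lambda>s. \<Sum>k<m. ?x k s"
  have S: "?S \<in> X" "N ?S \<le> (\<Sum>k<m. N (?x k))" using sum_mem_norm[of "{..<m}" ?x] x by auto
  have "distribution_fun F \<tau> = distribution_fun ?S \<tau>" if \<tau>: "\<tau> > 0" for \<tau>
  proof -
    have "distribution_fun ?S \<tau> = (\<Sum>k<m. distribution_fun (?x k) \<tau>)"
      by (rule distribution_fun_sum_disjoint) (use xm \<tau> in \<open>auto intro!: AE_I2 squeeze_disjoint simp del: times_divide_eq_right\<close>)
    also have "\<dots> = (\<Sum>k<m. ?c * distribution_fun F \<tau>)"
      using c kc \<tau> by (intro sum.cong refl distribution_fun_squeeze) auto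
    also have "\<dots> = distribution_fun F \<tau>" using m by simp
    finally show ?thesis by simp
  qed
  then have "F \<in> X" "N F = N ?S" using norm_eq_of_distribution[OF S(1) F] by auto
  then show "F \<in> X" "N F \<le> real m * N (squeeze ?c 0 F)" using S(2) x(2) by auto
qed

section \<open>Dilations\<close>

lemma dilation_measurable:
  assumes f: "f \<in> borel_measurable unit_leb" and \<tau>: "0 < \<tau>"
  shows "dilation \<tau> f \<in> borel_measurable unit_leb"
proof -
  have "(\<lambda>t. if t \<in> {0..min 1 \<tau>} then f (1 / \<tau> * t + 0) else 0) \<in> borel_measurable unit_leb"
    by (rule measurable_affine_unit_leb[OF f]) (use \<tau> in \<open>auto simp: field_simps\<close>)
  also have "(\<lambda>t. if t \<in> {0..min 1 \<tau>} then f (1 / \<tau> * t + 0) else 0) = dilation \<tau> f"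
    by (auto simp: dilation_def fun_eq_iff)
  finally show ?thesis .
qed

lemma distribution_fun_contraction:
  assumes \<tau>: "0 < \<tau>" "\<tau> \<le> 1" and l: "0 \<le> l"
  shows "distribution_fun (dilation \<tau> f) l = \<tau> * distribution_fun f l"
proof -
  have "distribution_fun (dilation \<tau> f) l = distribution_fun (squeeze \<tau> 0 f) l"
    by (rule distribution_fun_cong) (use \<tau> in \<open>auto simp: dilation_def squeeze_def\<close>)
  then show ?thesis using distribution_fun_squeeze[of \<tau> 0 l f] \<tau> l by simp
qed

lemma contraction_bounded:
  assumes f: "f \<in> X" and \<tau>: "0 < \<tau>" "\<tau> \<le> 1"
  shows "dilation \<tau> f \<in> X" "N (dilation \<tau> f) \<le> 1 * N f"
proof -
  have "distribution_fun (dilation \<tau> f) l \<le> distribution_fun f l" if "l > 0" for l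
    using that \<tau> mult_left_le_one_le[OF distribution_fun_nonneg[of f l], of \<tau>]
    by (simp add: distribution_fun_contraction)
  then show "dilation \<tau> f \<in> X" "N (dilation \<tau> f) \<le> 1 * N f"
    using norm_le_of_distribution[OF f dilation_measurable[OF measurable[OF f] \<tau>(1)]] by auto
qed

lemma expansion_bounded:
  assumes f: "f \<in> X" and m: "1 \<le> m"
  shows "dilation (real m) f \<in> X" "N (dilation (real m) f) \<le> real m * N f"
proof -
  let ?F = "dilation (real m) f"
  have Fm: "?F \<in> borel_measurable unit_leb"
    by (rule dilation_measurable[OF measurable[OF f]]) (use m in simp)
  have "\<bar>squeeze (1 / real m) 0 ?F s\<bar> \<le> \<bar>f s\<bar>" if "s \<in> {0..1}" for s
    using m that by (auto simp: squeeze_def dilation_def field_simps)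
  then have sq: "squeeze (1 / real m) 0 ?F \<in> X" "N (squeeze (1 / real m) 0 ?F) \<le> N f"
    using norm_mono[OF f squeeze_measurable[OF Fm]] m by auto
  show "?F \<in> X" by (rule norm_le_squeeze[OF Fm m sq(1)])
  have "N ?F \<le> real m * N (squeeze (1 / real m) 0 ?F)" by (rule norm_le_squeeze[OF Fm m sq(1)])
  also have "\<dots> \<le> real m * N f" using sq(2) m by simp
  finally show "N ?F \<le> real m * N f" .
qed

text \<open>The factors must lie on the same side of \<open>1\<close>: an expansion cuts off the values of \<open>f\<close> near
  \<open>1\<close>, and a later contraction does not bring them back.\<close>

lemma dilation_dilation:
  assumes "(1 \<le> \<sigma> \<and> 1 \<le> \<tau>) \<or> (0 < \<sigma> \<and> \<sigma> \<le> 1 \<and> 0 < \<tau> \<and> \<tau> \<le> 1)"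
  shows "dilation \<sigma> (dilation \<tau> f) = dilation (\<sigma> * \<tau>) f"
proof
  fix t
  show "dilation \<sigma> (dilation \<tau> f) t = dilation (\<sigma> * \<tau>) f t"
    using assms
  proof
    assume a: "1 \<le> \<sigma> \<and> 1 \<le> \<tau>"
    then have "1 \<le> \<sigma> * \<tau>" using mult_mono[of 1 \<sigma> 1 \<tau>] by simp
    moreover have "t / \<sigma> \<le> 1" if "0 \<le> t" "t \<le> 1" using that a by (simp add: field_simps)
    ultimately show ?thesis using a by (auto simp: dilation_def min_def mult.commute)
  next
    assume a: "0 < \<sigma> \<and> \<sigma> \<le> 1 \<and> 0 < \<tau> \<and> \<tau> \<le> 1"
    then have 1: "\<sigma> * \<tau> \<le> \<sigma>" by (simp add: mult_left_le)
    then have "\<sigma> * \<tau> \<le> 1" using a by linarith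
    then have "min 1 (\<sigma> * \<tau>) = \<sigma> * \<tau>" "min 1 \<sigma> = \<sigma>" "min 1 \<tau> = \<tau>" using a by auto
    then have "dilation \<sigma> (dilation \<tau> f) t
        = (if 0 \<le> t \<and> t \<le> \<sigma> \<and> t \<le> \<sigma> * \<tau> then f (t / (\<sigma> * \<tau>)) else 0)"
      using a by (auto simp: dilation_def field_simps)
    then show ?thesis using 1 \<open>min 1 (\<sigma> * \<tau>) = \<sigma> * \<tau>\<close> by (auto simp: dilation_def)
  qed
qed

text \<open>Any bound on the operator makes the supremum that defines its norm genuine.\<close>

lemma dilation_norm_bound:
  assumes K: "0 \<le> K" "\<And>f. f \<in> X \<Longrightarrow> dilation \<tau> f \<in> X \<and> N (dilation \<tau> f) \<le> K * N f"
  shows "f \<in> X \<Longrightarrow> N (dilation \<tau> f) \<le> dilation_norm X N \<tau> * N f"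
    and "dilation_norm X N \<tau> \<le> K"
proof -
  have le: "N (dilation \<tau> f) \<le> K" if "f \<in> X" "N f \<le> 1" for f
  proof -
    have "K * N f \<le> K * 1" using that K(1) by (intro mult_left_mono) auto
    then show ?thesis using K(2)[OF that(1)] by simp
  qed
  have bdd: "bdd_above {N (dilation \<tau> f) | f. f \<in> X \<and> N f \<le> 1}"
    by (rule bdd_aboveI[where M=K]) (use le in auto)
  show "dilation_norm X N \<tau> \<le> K" unfolding dilation_norm_def
    by (rule cSup_least) (use le zero_mem norm_eq_0_iff[OF zero_mem] in auto)
  assume f: "f \<in> X"
  show "N (dilation \<tau> f) \<le> dilation_norm X N \<tau> * N f"
  proof (cases "N f = 0")
    case True
    then show ?thesis using K(2)[OF f] by simp
  next
    case False
    then have pos: "0 < N f" using norm_nonneg[OF f] by simp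
    let ?g = "\<lambda>s. 1 / N f * f s"
    have g: "?g \<in> X" "N ?g \<le> 1"
      using scale_mem[OF f, of "1 / N f"] norm_scale[OF f, of "1 / N f"] pos by auto
    have "dilation \<tau> ?g = (\<lambda>s. 1 / N f * dilation \<tau> f s)" by (auto simp: dilation_def)
    then have "N (dilation \<tau> ?g) = 1 / N f * N (dilation \<tau> f)"
      using norm_scale[of "dilation \<tau> f" "1 / N f"] K(2)[OF f] pos by simp
    moreover have "N (dilation \<tau> ?g) \<le> dilation_norm X N \<tau>"
      unfolding dilation_norm_def by (rule cSup_upper[OF _ bdd]) (use g in blast)
    ultimately have "N f * (1 / N f * N (dilation \<tau> f)) \<le> N f * dilation_norm X N \<tau>"
      using pos by (intro mult_left_mono) auto
    then show ?thesis using pos by (simp add: mult.commute)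
  qed
qed

lemma dilation_norm_mult:
  assumes \<sigma>\<tau>: "(1 \<le> \<sigma> \<and> 1 \<le> \<tau>) \<or> (0 < \<sigma> \<and> \<sigma> \<le> 1 \<and> 0 < \<tau> \<and> \<tau> \<le> 1)"
    and K: "0 \<le> K" "\<And>f. f \<in> X \<Longrightarrow> dilation \<sigma> f \<in> X \<and> N (dilation \<sigma> f) \<le> K * N f"
    and K': "0 \<le> K'" "\<And>f. f \<in> X \<Longrightarrow> dilation \<tau> f \<in> X \<and> N (dilation \<tau> f) \<le> K' * N f"
  shows "dilation_norm X N (\<sigma> * \<tau>) \<le> dilation_norm X N \<sigma> * dilation_norm X N \<tau>"
proof -
  have u: "0 \<le> dilation_norm X N s"
    if "0 \<le> K" "\<And>f. f \<in> X \<Longrightarrow> dilation s f \<in> X \<and> N (dilation s f) \<le> K * N f" for K s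
  proof -
    have "0 \<le> N (dilation s (indicator {0..1}))" using that(2)[OF unit_mem] norm_nonneg by blast
    also have "\<dots> \<le> dilation_norm X N s * N (indicator {0..1})"
      by (rule dilation_norm_bound(1)[OF that unit_mem])
    finally show ?thesis by (simp add: norm_unit)
  qed
  have "dilation (\<sigma> * \<tau>) f \<in> X \<and>
    N (dilation (\<sigma> * \<tau>) f) \<le> (dilation_norm X N \<sigma> * dilation_norm X N \<tau>) * N f" if f: "f \<in> X" for f
  proof -
    have m: "dilation \<tau> f \<in> X" using K'(2)[OF f] by simp
    have "N (dilation \<sigma> (dilation \<tau> f)) \<le> dilation_norm X N \<sigma> * N (dilation \<tau> f)"
      by (rule dilation_norm_bound(1)[OF K m])
    also have "\<dots> \<le> dilation_norm X N \<sigma> * (dilation_norm X N \<tau> * N f)"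
      by (intro mult_left_mono dilation_norm_bound(1)[OF K' f] u[OF K])
    finally show ?thesis using K(2)[OF m] dilation_dilation[OF \<sigma>\<tau>, of f] by (simp add: mult.assoc)
  qed
  then show ?thesis
    by (intro dilation_norm_bound(2)) (simp_all add: u[OF K] u[OF K'])
qed

lemma contraction_power:
  "f \<in> X \<Longrightarrow> dilation (1 / 2 ^ n) f \<in> X \<and> N (dilation (1 / 2 ^ n) f) \<le> 1 * N f"
  using contraction_bounded[of f "1 / 2 ^ n"] by simp

lemma expansion_power:
  "f \<in> X \<Longrightarrow> dilation (2 ^ n) f \<in> X \<and> N (dilation (2 ^ n) f) \<le> 2 ^ n * N f"
  using expansion_bounded[of f "2 ^ n"] by simp

lemma contraction_norm_lower: "1 / 2 ^ n \<le> dilation_norm X N (1 / 2 ^ n)"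
proof -
  let ?u = "indicator {0..1} :: real \<Rightarrow> real"
  let ?d = "dilation (1 / 2 ^ n) ?u"
  have d: "?d \<in> X" using contraction_power[OF unit_mem] by simp
  have "squeeze (1 / real (2 ^ n)) 0 ?u \<in> X"
    by (rule squeeze_mem[OF unit_mem]) auto
  note sq = norm_le_squeeze[OF measurable[OF unit_mem] _ this]
  have "N (squeeze (1 / real (2 ^ n)) 0 ?u) \<le> N ?d"
    by (rule norm_mono[OF d squeeze_measurable[OF measurable[OF unit_mem]]])
       (auto simp: squeeze_def dilation_def)
  also have "\<dots> \<le> dilation_norm X N (1 / 2 ^ n)"
    using dilation_norm_bound(1)[OF _ contraction_power unit_mem] norm_unit by simp
  finally have *: "N (squeeze (1 / real (2 ^ n)) 0 ?u) \<le> dilation_norm X N (1 / 2 ^ n)" .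
  have "1 \<le> 2 ^ n * N (squeeze (1 / real (2 ^ n)) 0 ?u)"
    using sq(2) norm_unit by simp
  also have "\<dots> \<le> 2 ^ n * dilation_norm X N (1 / 2 ^ n)" using * by simp
  finally show ?thesis by (simp add: field_simps)
qed

lemma expansion_norm_lower: "1 \<le> dilation_norm X N (2 ^ n)"
proof -
  let ?u = "indicator {0..1} :: real \<Rightarrow> real"
  let ?d = "dilation (2 ^ n) ?u"
  have d: "?d \<in> X" using expansion_power[OF unit_mem] by simp
  have "s / 2 ^ n \<le> 1" if "0 \<le> s" "s \<le> 1" for s :: real
    using that order_trans[of s 1 "2 ^ n"] by (simp add: field_simps)
  then have "N ?u \<le> N ?d"
    by (intro norm_mono(2)[OF d measurable[OF unit_mem]]) (auto simp: dilation_def indicator_def)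
  also have "\<dots> \<le> dilation_norm X N (2 ^ n)"
    using dilation_norm_bound(1)[OF _ expansion_power unit_mem] norm_unit by simp
  finally show ?thesis by (simp add: norm_unit)
qed

lemma lower_boyd_limit:
  shows "(\<lambda>n. 1 / real n * log 2 (dilation_norm X N (1 / 2 ^ n))) \<longlonglongrightarrow> - lower_boyd X N"
    and "2 powr (- lower_boyd X N * real n) \<le> dilation_norm X N (1 / 2 ^ n)"
proof -
  have "dilation_norm X N (1 / 2 ^ (m + n)) \<le> dilation_norm X N (1 / 2 ^ m) * dilation_norm X N (1 / 2 ^ n)"
    for m n
    using dilation_norm_mult[OF _ _ contraction_power[of _ m] _ contraction_power[of _ n]]
    by (simp add: power_add)
  note * = submultiplicative_growth[where h="\<lambda>n. dilation_norm X N (1 / 2 ^ n)", OF this contraction_norm_lower]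
  show "(\<lambda>n. 1 / real n * log 2 (dilation_norm X N (1 / 2 ^ n))) \<longlonglongrightarrow> - lower_boyd X N"
    "2 powr (- lower_boyd X N * real n) \<le> dilation_norm X N (1 / 2 ^ n)"
    using * unfolding lower_boyd_def by simp_all
qed

lemma upper_boyd_limit:
  shows "(\<lambda>n. 1 / real n * log 2 (dilation_norm X N (2 ^ n))) \<longlonglongrightarrow> upper_boyd X N"
proof -
  have "dilation_norm X N (2 ^ (m + n)) \<le> dilation_norm X N (2 ^ m) * dilation_norm X N (2 ^ n)"
    for m n
    using dilation_norm_mult[OF _ _ expansion_power[of _ m] _ expansion_power[of _ n]]
    by (simp add: power_add)
  moreover have "1 / 2 ^ n \<le> dilation_norm X N (2 ^ n)" for n
    by (rule order_trans[OF _ expansion_norm_lower]) simp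
  ultimately show ?thesis
    using submultiplicative_growth(1)[where h="\<lambda>n. dilation_norm X N (2 ^ n)"]
    unfolding upper_boyd_def by simp
qed

lemma boyd_bounds: "0 \<le> lower_boyd X N" "0 \<le> upper_boyd X N" "upper_boyd X N \<le> 1"
proof -
  have pos: "0 < dilation_norm X N (1 / 2 ^ n)" for n
    by (rule less_le_trans[OF _ contraction_norm_lower]) simp
  have "log 2 (dilation_norm X N (1 / 2 ^ n)) \<le> 0" for n
    using dilation_norm_bound(2)[OF _ contraction_power] pos[of n] by simp
  then have "1 / real n * log 2 (dilation_norm X N (1 / 2 ^ n)) \<le> 0" for n
    by (simp add: divide_nonpos_nonneg)
  then show "0 \<le> lower_boyd X N"
    using LIMSEQ_le_const2[OF lower_boyd_limit(1), of 0] by auto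
  have 1: "0 \<le> log 2 (dilation_norm X N (2 ^ n))" for n
    using expansion_norm_lower[of n] by simp
  then show "0 \<le> upper_boyd X N"
    by (intro LIMSEQ_le_const[OF upper_boyd_limit]) simp
  have "1 / real n * log 2 (dilation_norm X N (2 ^ n)) \<le> 1" for n
  proof -
    have "log 2 (dilation_norm X N (2 ^ n)) \<le> real n"
      using dilation_norm_bound(2)[OF _ expansion_power[of _ n]] expansion_norm_lower[of n]
      by (simp add: log_le_iff powr_realpow)
    then show ?thesis by (cases "n = 0") (auto simp: field_simps)
  qed
  then show "upper_boyd X N \<le> 1"
    by (intro LIMSEQ_le_const2[OF upper_boyd_limit]) auto
qed

end

section \<open>Necessity of the Boyd index bounds\<close>

text \<open>Real-valued, for comparison with the Boyd indices.\<close>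

definition inv_exponent :: "ereal \<Rightarrow> real" where
  "inv_exponent p = (if p = \<infinity> then 0 else 1 / real_of_ereal p)"

lemma lp_norm_ones:
  assumes "1 \<le> n"
  shows "lp_norm p n (\<lambda>_. 1) = real n powr inv_exponent p"
proof -
  have "Max ((\<lambda>k. \<bar>1 :: real\<bar>) ` {1..n}) = 1" using assms by (simp add: image_constant_conv)
  then show ?thesis using assms by (simp add: lp_norm_def inv_exponent_def)
qed

lemma lp_norm_unit_vector:
  assumes "1 \<le> n" "1 \<le> p"
  shows "lp_norm p n (\<lambda>k. if k = 1 then 1 else 0) = 1"
proof (cases "p = \<infinity>")
  case True
  have "(\<lambda>k. \<bar>if k = 1 then 1 else 0 :: real\<bar>) ` {1..n} \<subseteq> {0, 1}" by auto
  moreover have "1 \<in> (\<lambda>k. \<bar>if k = 1 then 1 else 0 :: real\<bar>) ` {1..n}"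
    using assms(1) by (intro image_eqI[where x=1]) auto
  ultimately have "Max ((\<lambda>k. \<bar>if k = 1 then 1 else 0 :: real\<bar>) ` {1..n}) = 1"
    by (intro Max_eqI) auto
  then show ?thesis using True by (simp add: lp_norm_def)
next
  case False
  then obtain r where r: "p = ereal r" "1 \<le> r" using assms(2) by (cases p) auto
  have "(\<Sum>k=1..n. \<bar>if k = 1 then 1 else 0 :: real\<bar> powr r) = (\<Sum>k=1..n. if k = 1 then 1 else 0)"
    using r by (intro sum.cong) auto
  then show ?thesis using r assms(1) by (simp add: lp_norm_def)
qed

context ri_space
begin

text \<open>The sum \<open>S\<close> of the system and its compression, which is equimeasurable with one of its
  members, are exchanged by the dilations of factors \<open>n\<close> and \<open>1 / n\<close>. Their norms are of order
  \<open>n powr (1/p)\<close> and \<open>1\<close>.\<close>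

lemma lp_equivalent_dilation_norms:
  assumes n: "1 \<le> n" and p: "1 \<le> p" and C: "0 < C"
    and sys: "symmetric_system X n x" and eqv: "lp_equivalent N p C n x"
  shows "real n powr inv_exponent p \<le> C\<^sup>2 * dilation_norm X N (real n)"
    and "1 \<le> C\<^sup>2 * real n powr inv_exponent p * dilation_norm X N (1 / real n)"
proof -
  define S where "S = (\<lambda>s. \<Sum>k=1..n. x k s)"
  define y where "y = dilation (1 / real n) S"
  let ?v = "real n powr inv_exponent p"
  have xX: "x k \<in> X" if "k \<in> {1..n}" for k using sys that by (simp add: symmetric_system_def)
  have SX: "S \<in> X" using sum_mem_norm[of "{1..n}" x] xX by (simp add: S_def)
  have NS: "inverse C * ?v \<le> N S" "N S \<le> C * ?v"
    using eqv[unfolded lp_equivalent_def, rule_format, of "\<lambda>_. 1"] lp_norm_ones[OF n, of p]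
    by (simp_all add: S_def)
  have "(\<lambda>s. \<Sum>k=1..n. (if k = 1 then 1 else 0) * x k s) = x 1"
  proof
    fix s
    have "(\<Sum>k=1..n. (if k = 1 then 1 else 0) * x k s) = (\<Sum>k=1..n. if k = 1 then x k s else 0)"
      by (intro sum.cong) auto
    then show "(\<Sum>k=1..n. (if k = 1 then 1 else 0) * x k s) = x 1 s" using n by simp
  qed
  then have N1: "inverse C \<le> N (x 1)" "N (x 1) \<le> C"
    using eqv[unfolded lp_equivalent_def, rule_format, of "\<lambda>k. if k = 1 then 1 else 0"]
      lp_norm_unit_vector[OF n p] by simp_all
  have x1: "x 1 \<in> X" using xX n by simp
  have "distribution_fun y \<tau> = distribution_fun (x 1) \<tau>" if \<tau>: "\<tau> > 0" for \<tau>
  proof -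
    have "distribution_fun S \<tau> = (\<Sum>k=1..n. distribution_fun (x k) \<tau>)"
      unfolding S_def
      by (rule distribution_fun_sum_disjoint)
         (use sys xX measurable \<tau> in \<open>auto simp: symmetric_system_def\<close>)
    also have "\<dots> = (\<Sum>k=1..n. distribution_fun (x 1) \<tau>)"
    proof (intro sum.cong refl)
      fix k assume "k \<in> {1..n}"
      then have "equimeasurable (x k) (x 1)" using sys n by (simp add: symmetric_system_def)
      then show "distribution_fun (x k) \<tau> = distribution_fun (x 1) \<tau>"
        using \<tau> unfolding equimeasurable_def by blast
    qed
    finally have "distribution_fun S \<tau> = real n * distribution_fun (x 1) \<tau>" by simp
    then show ?thesis using n \<tau> by (simp add: y_def distribution_fun_contraction)
  qed
  then have y: "y \<in> X" "N y = N (x 1)"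
    using norm_eq_of_distribution[OF x1 dilation_measurable[OF measurable[OF SX]]] n
    by (auto simp: y_def)
  have "distribution_fun (dilation (real n) y) \<tau> = distribution_fun S \<tau>" for \<tau>
    by (rule distribution_fun_cong) (use n in \<open>auto simp: y_def dilation_def divide_right_mono\<close>)
  then have Ny: "N (dilation (real n) y) = N S"
    using norm_eq_of_distribution[OF SX dilation_measurable[OF measurable[OF y(1)]]] n by auto
  have up: "N (dilation (real n) f) \<le> dilation_norm X N (real n) * N f" if "f \<in> X" for f
    by (rule dilation_norm_bound(1)[where K="real n"]) (use expansion_bounded[OF _ n] that in auto)
  have dn: "N (dilation (1 / real n) f) \<le> dilation_norm X N (1 / real n) * N f" if "f \<in> X" for f
    by (rule dilation_norm_bound(1)[where K=1])
       (use n that contraction_bounded[of _ "1 / real n"] in simp_all)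
  have nn: "0 \<le> dilation_norm X N (real n)" "0 \<le> dilation_norm X N (1 / real n)"
    using norm_nonneg[OF expansion_bounded(1)[OF unit_mem n]] up[OF unit_mem]
      norm_nonneg[OF contraction_bounded(1)[OF unit_mem, of "1 / real n"]] dn[OF unit_mem] n
    by (simp_all add: norm_unit)
  have "inverse C * ?v \<le> dilation_norm X N (real n) * N y"
    using up[OF y(1)] Ny NS(1) by simp
  also have "\<dots> \<le> dilation_norm X N (real n) * C"
    using y N1 nn by (intro mult_left_mono) auto
  finally show "?v \<le> C\<^sup>2 * dilation_norm X N (real n)"
    using C by (simp add: field_simps power2_eq_square)
  have "inverse C \<le> dilation_norm X N (1 / real n) * N S"
    using dn[OF SX] y(2) N1(1) unfolding y_def by simp
  also have "\<dots> \<le> dilation_norm X N (1 / real n) * (C * ?v)"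
    using NS nn by (intro mult_left_mono) auto
  finally show "1 \<le> C\<^sup>2 * ?v * dilation_norm X N (1 / real n)"
    using C by (simp add: field_simps power2_eq_square)
qed

text \<open>Along \<open>n = 2 ^ m\<close> the constant \<open>C\<close> vanishes in the limit, after taking logarithms and
  dividing by \<open>m\<close>.\<close>

lemma crude_sym_fin_rep_boyd:
  assumes rep: "crude_sym_fin_rep X N p" and p: "1 \<le> p"
  shows "lower_boyd X N \<le> inv_exponent p" "inv_exponent p \<le> upper_boyd X N"
proof -
  let ?\<theta> = "inv_exponent p"
  obtain C where C: "C > 0"
    and ex: "\<And>n. 1 \<le> n \<Longrightarrow> \<exists>x. symmetric_system X n x \<and> lp_equivalent N p C n x"
    using rep by (auto simp: crude_sym_fin_rep_def)
  define K where "K = log 2 (C\<^sup>2)"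
  have v: "real (2 ^ m) powr ?\<theta> = 2 powr (real m * ?\<theta>)" for m :: nat
    by (simp add: powr_powr powr_realpow[symmetric])
  have step: "2 powr (real m * ?\<theta>) \<le> C\<^sup>2 * dilation_norm X N (2 ^ m)"
    "1 \<le> C\<^sup>2 * 2 powr (real m * ?\<theta>) * dilation_norm X N (1 / 2 ^ m)" for m :: nat
  proof -
    have "1 \<le> (2::nat) ^ m" by simp
    then obtain x where "symmetric_system X (2 ^ m) x" "lp_equivalent N p C (2 ^ m) x" using ex by blast
    from lp_equivalent_dilation_norms[OF _ p C this]
    show "2 powr (real m * ?\<theta>) \<le> C\<^sup>2 * dilation_norm X N (2 ^ m)"
      "1 \<le> C\<^sup>2 * 2 powr (real m * ?\<theta>) * dilation_norm X N (1 / 2 ^ m)"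
      unfolding v by simp_all
  qed
  have K0: "(\<lambda>m. K / real m) \<longlonglongrightarrow> 0" by (rule lim_const_over_n)
  have up: "?\<theta> \<le> K / real m + 1 / real m * log 2 (dilation_norm X N (2 ^ m))" if "1 \<le> m" for m
  proof -
    have pos: "0 < dilation_norm X N (2 ^ m)" using expansion_norm_lower[of m] by simp
    have "log 2 (2 powr (real m * ?\<theta>)) \<le> log 2 (C\<^sup>2 * dilation_norm X N (2 ^ m))"
      using step(1)[of m] C pos by (subst log_le_cancel_iff) auto
    then have "real m * ?\<theta> \<le> K + log 2 (dilation_norm X N (2 ^ m))"
      using C pos by (simp add: log_mult K_def)
    then show ?thesis using that by (simp add: field_simps)
  qed
  have lo: "0 \<le> K / real m + ?\<theta> + 1 / real m * log 2 (dilation_norm X N (1 / 2 ^ m))" if "1 \<le> m" for m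
  proof -
    have pos: "0 < dilation_norm X N (1 / 2 ^ m)"
      by (rule less_le_trans[OF _ contraction_norm_lower]) simp
    have "log 2 1 \<le> log 2 (C\<^sup>2 * 2 powr (real m * ?\<theta>) * dilation_norm X N (1 / 2 ^ m))"
      using step(2)[of m] C pos by (subst log_le_cancel_iff) auto
    then have "0 \<le> K + real m * ?\<theta> + log 2 (dilation_norm X N (1 / 2 ^ m))"
      using C pos by (simp add: log_mult K_def)
    then have "0 \<le> (K + real m * ?\<theta> + log 2 (dilation_norm X N (1 / 2 ^ m))) / real m" by simp
    then show ?thesis using that by (simp add: add_divide_distrib)
  qed
  have "?\<theta> \<le> 0 + upper_boyd X N"
    by (rule LIMSEQ_le_const[OF tendsto_add[OF K0 upper_boyd_limit]]) (use up in blast)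
  then show "?\<theta> \<le> upper_boyd X N" by simp
  have "0 \<le> (0 + ?\<theta>) + - lower_boyd X N"
    by (rule LIMSEQ_le_const[OF tendsto_add[OF tendsto_add[OF K0 tendsto_const] lower_boyd_limit(1)]])
       (use lo in blast)
  then show "lower_boyd X N \<le> ?\<theta>" by simp
qed

section \<open>The exponent infinity\<close>

text \<open>If the lower Boyd index vanishes, contractions do not decrease all norms, so some \<open>f\<close>
  in the unit ball has a contraction of norm almost \<open>1\<close>. Disjoint copies of that contraction all
  have norm almost \<open>1\<close>, while their sum has norm at most that of \<open>f\<close>.\<close>

lemma sym_fin_rep_infinity:
  assumes "lower_boyd X N = 0"
  shows "sym_fin_rep X N \<infinity>"
  unfolding sym_fin_rep_def
proof (intro allI impI)
  fix n :: nat and \<epsilon> :: real assume n: "1 \<le> n" and \<epsilon>: "0 < \<epsilon>"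
  \<comment> \<open>\<open>n \<le> 2 ^ n\<close> disjoint copies of length \<open>1 / 2 ^ n\<close> fit into the unit interval.\<close>
  define c where "c = 1 / (2::real) ^ n"
  have c: "0 < c" "c \<le> 1" by (simp_all add: c_def)
  have "real n < 2 ^ n" by (rule of_nat_less_two_power)
  then have nc: "real n * c \<le> 1" by (simp add: c_def)
  have "1 \<le> dilation_norm X N c"
    using lower_boyd_limit(2)[of n] assms by (simp add: c_def)
  then have "1 / (1 + \<epsilon>) < Sup {N (dilation c f) | f. f \<in> X \<and> N f \<le> 1}"
    unfolding dilation_norm_def[symmetric] by (rule less_le_trans[rotated]) (use \<epsilon> in simp)
  moreover have "{N (dilation c f) | f. f \<in> X \<and> N f \<le> 1} \<noteq> {}" using unit_mem norm_unit by force
  ultimately obtain f where f: "f \<in> X" "N f \<le> 1" "1 / (1 + \<epsilon>) < N (dilation c f)"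
    using less_cSupD[of "{N (dilation c f) | f. f \<in> X \<and> N f \<le> 1}" "1 / (1 + \<epsilon>)"] by blast
  define x where "x k = squeeze c (real (k - 1) * c) f" for k
  have in1: "0 \<le> real (k - 1) * c" "real (k - 1) * c + c \<le> 1" if "k \<in> {1..n}" for k
  proof -
    have "real (k - 1) * c + c = real k * c" using that by (simp add: of_nat_diff algebra_simps)
    also have "\<dots> \<le> real n * c" using that c by (intro mult_right_mono) auto
    finally show "real (k - 1) * c + c \<le> 1" using nc by simp
  qed (use c in simp)
  have xd: "distribution_fun (x k) \<tau> = c * distribution_fun f \<tau>" if "k \<in> {1..n}" "\<tau> \<ge> 0" for k \<tau>
    using distribution_fun_squeeze[OF c(1) in1[OF that(1)] that(2)] by (simp add: x_def)
  have xX: "x k \<in> X" if "k \<in> {1..n}" for k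
    using squeeze_mem(1)[OF f(1) c(1) in1[OF that]] by (simp add: x_def)
  have disj: "x i s = 0 \<or> x j s = 0" if "i \<in> {1..n}" "j \<in> {1..n}" "i \<noteq> j" for i j s
    unfolding x_def by (rule squeeze_disjoint) (use that in auto)
  have Nx: "N (x k) = N (dilation c f)" if "k \<in> {1..n}" for k
    by (rule norm_eq_of_distribution(2)[OF _ measurable[OF xX[OF that]]])
       (use contraction_bounded[OF f(1) c] xd[OF that] c in \<open>auto simp: distribution_fun_contraction\<close>)
  define T where "T = (\<lambda>s. \<Sum>k=1..n. x k s)"
  have TX: "T \<in> X" using sum_mem_norm[of "{1..n}" x] xX by (simp add: T_def)
  have "distribution_fun T \<tau> \<le> distribution_fun f \<tau>" if "\<tau> > 0" for \<tau>
  proof -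
    have "distribution_fun T \<tau> = (\<Sum>k=1..n. distribution_fun (x k) \<tau>)"
      unfolding T_def
      by (rule distribution_fun_sum_disjoint) (use xX measurable disj that in \<open>auto intro!: AE_I2\<close>)
    also have "\<dots> = (real n * c) * distribution_fun f \<tau>" using xd that by simp
    also have "\<dots> \<le> distribution_fun f \<tau>"
      using nc c by (intro mult_left_le_one_le distribution_fun_nonneg) auto
    finally show ?thesis .
  qed
  then have NT: "N T \<le> 1" using norm_le_of_distribution(2)[OF f(1) measurable[OF TX]] f(2) by simp
  have "lp_equivalent N \<infinity> (1 + \<epsilon>) n x"
    unfolding lp_equivalent_def
  proof (intro allI conjI)
    fix a :: "nat \<Rightarrow> real"
    let ?A = "(\<lambda>k. \<bar>a k\<bar>) ` {1..n}"
    let ?S = "\<lambda>s. \<Sum>k=1..n. a k * x k s"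
    have lp: "lp_norm \<infinity> n a = Max ?A" by (simp add: lp_norm_def)
    have A: "finite ?A" "?A \<noteq> {}" using n by auto
    have SX: "?S \<in> X" using sum_mem_norm[of "{1..n}" "\<lambda>k s. a k * x k s"] xX scale_mem by simp
    have at: "?S s = a k * x k s" "T s = x k s" if "k \<in> {1..n}" "x k s \<noteq> 0" for k s
    proof -
      have z: "x i s = 0" if "i \<in> {1..n}" "i \<noteq> k" for i
        using disj[of i k s] that \<open>k \<in> {1..n}\<close> \<open>x k s \<noteq> 0\<close> by auto
      show "?S s = a k * x k s" "T s = x k s"
        unfolding T_def using that z by (subst sum.remove[of _ k]; auto)+
    qed
    obtain j where j: "j \<in> {1..n}" "Max ?A = \<bar>a j\<bar>" using Max_in[OF A] by auto
    have "\<bar>a j * x j s\<bar> \<le> \<bar>?S s\<bar>" for s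
      using at(1)[OF j(1), of s] by (cases "x j s = 0") auto
    then have "\<bar>a j\<bar> * N (x j) \<le> N ?S"
      using norm_mono(2)[OF SX measurable[OF scale_mem[OF xX[OF j(1)], of "a j"]]]
        norm_scale[OF xX[OF j(1)], of "a j"] by simp
    moreover have "\<bar>a j\<bar> * (1 / (1 + \<epsilon>)) \<le> \<bar>a j\<bar> * N (x j)"
      using f(3) Nx[OF j(1)] by (intro mult_left_mono) auto
    ultimately show "inverse (1 + \<epsilon>) * lp_norm \<infinity> n a \<le> N ?S"
      using lp j by (simp add: field_simps)
    have "\<bar>?S s\<bar> \<le> \<bar>Max ?A * T s\<bar>" for s
    proof (cases "\<exists>k\<in>{1..n}. x k s \<noteq> 0")
      case True
      then obtain k where k: "k \<in> {1..n}" "x k s \<noteq> 0" by blast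
      have "\<bar>a k\<bar> \<le> Max ?A" using k A by (intro Max_ge) auto
      then show ?thesis using at[OF k] j by (simp add: abs_mult mult_right_mono)
    qed (simp add: T_def)
    then have "N ?S \<le> \<bar>Max ?A\<bar> * N T"
      using norm_mono(2)[OF scale_mem[OF TX] measurable[OF SX], of "Max ?A"] norm_scale[OF TX, of "Max ?A"]
      by simp
    also have "\<dots> \<le> Max ?A * (1 + \<epsilon>)" using NT \<epsilon> j by (intro mult_mono) (auto simp: norm_nonneg[OF TX])
    finally show "N ?S \<le> (1 + \<epsilon>) * lp_norm \<infinity> n a" using lp by (simp add: mult.commute)
  qed
  moreover have "symmetric_system X n x"
    using xX disj xd by (auto simp: symmetric_system_def equimeasurable_def intro!: AE_I2)
  ultimately show "\<exists>x. symmetric_system X n x \<and> lp_equivalent N \<infinity> (1 + \<epsilon>) n x" by blast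
qed

end

section \<open>Growth of the fundamental function\<close>

context ri_space
begin

lemma indicator_mem:
  assumes "A \<in> sets unit_leb"
  shows "indicator A \<in> X"
proof (rule norm_mono(1)[OF unit_mem])
  show "indicator A \<in> borel_measurable unit_leb" using assms by (rule borel_measurable_indicator)
  show "\<bar>indicator A s :: real\<bar> \<le> \<bar>indicator {0..1} s\<bar>" if "s \<in> {0..1}" for s :: real
    using that by (simp add: indicator_def)
qed

lemma interval_mem: "{0..t} \<in> sets unit_leb" if "t \<le> 1" for t :: real
proof -
  have "{0..1} \<inter> {0..t} = {0..t}" using that by auto
  then show ?thesis by (metis atLeastAtMost_borel image_eqI sets_completionI_sets sets_lborel sets_restrict_space)
qed

lemma fundamental_fun_mono:
  assumes "s \<le> t" "t \<le> 1"
  shows "fundamental_fun N s \<le> fundamental_fun N t"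
  unfolding fundamental_fun_def
proof (rule norm_mono(2))
  show "indicator {0..t} \<in> X" using assms by (intro indicator_mem interval_mem) simp
  show "indicator {0..s} \<in> borel_measurable unit_leb"
    using assms by (intro borel_measurable_indicator interval_mem) simp
qed (use assms in \<open>simp add: indicator_def\<close>)

lemma fundamental_fun_pos:
  assumes "0 < t" "t \<le> 1"
  shows "0 < fundamental_fun N t"
  unfolding fundamental_fun_def
proof (rule norm_pos[where \<tau>=0])
  show "indicator {0..t} \<in> X" using assms by (intro indicator_mem interval_mem) auto
  have "{s \<in> {0<..1}. \<bar>indicator {0..t} s :: real\<bar> > 0} = {0<..t}"
    using assms by (auto simp: indicator_def)
  then show "0 < distribution_fun (indicator {0..t}) 0"
    using assms by (simp add: distribution_fun_half_open)
qed simp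

lemma fundamental_fun_multiple:
  assumes m: "1 \<le> m" and t: "0 \<le> t" "real m * t \<le> 1"
  shows "fundamental_fun N (real m * t) \<le> real m * fundamental_fun N t"
proof -
  let ?F = "indicator {0..real m * t} :: real \<Rightarrow> real"
  let ?q = "squeeze (1 / real m) 0 ?F"
  have Fm: "?F \<in> borel_measurable unit_leb"
    using measurable[OF indicator_mem[OF interval_mem]] t(2) by simp
  have "1 * t \<le> real m * t" using m t by (intro mult_right_mono) auto
  then have t1: "t \<le> 1" using t by simp
  have "\<bar>?q s\<bar> \<le> \<bar>indicator {0..t} s\<bar>" for s
    using m by (auto simp: squeeze_def indicator_def field_simps)
  then have q: "?q \<in> X" "N ?q \<le> fundamental_fun N t"
    using norm_mono[OF indicator_mem[OF interval_mem[OF t1]] squeeze_measurable[OF Fm]] m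
    by (auto simp: fundamental_fun_def)
  have "N ?F \<le> real m * N ?q" by (rule norm_le_squeeze(2)[OF Fm m q(1)])
  also have "\<dots> \<le> real m * fundamental_fun N t" using q m by simp
  finally show ?thesis by (simp add: fundamental_fun_def)
qed

lemma dilation_fun_bound:
  assumes t: "0 < t"
    and K: "\<And>s. 0 < s \<Longrightarrow> s \<le> min 1 (1 / t) \<Longrightarrow>
      fundamental_fun N (t * s) \<le> K * fundamental_fun N s"
    and s: "0 < s" "s \<le> min 1 (1 / t)"
  shows "fundamental_fun N (t * s) / fundamental_fun N s \<le> dilation_fun (fundamental_fun N) t"
  unfolding dilation_fun_def
proof (rule cSup_upper)
  show "bdd_above {fundamental_fun N (t * s) / fundamental_fun N s |s. 0 < s \<and> s \<le> min 1 (1 / t)}"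
    by (rule bdd_aboveI[where M=K])
       (use K fundamental_fun_pos in \<open>auto simp: pos_divide_le_eq\<close>)
qed (use s in blast)

lemma dilation_fun_mult:
  assumes st: "(1 \<le> s \<and> 1 \<le> t) \<or> (0 < s \<and> s \<le> 1 \<and> 0 < t \<and> t \<le> 1)"
    and K: "\<And>u. 0 < u \<Longrightarrow> u \<le> min 1 (1 / s) \<Longrightarrow>
      fundamental_fun N (s * u) \<le> K * fundamental_fun N u"
    and K': "\<And>u. 0 < u \<Longrightarrow> u \<le> min 1 (1 / t) \<Longrightarrow>
      fundamental_fun N (t * u) \<le> K' * fundamental_fun N u"
  shows "dilation_fun (fundamental_fun N) (s * t)
    \<le> dilation_fun (fundamental_fun N) s * dilation_fun (fundamental_fun N) t"
proof -
  let ?\<phi> = "fundamental_fun N"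
  have st0: "0 < s" "0 < t" using st by auto
  have "?\<phi> (s * t * u) / ?\<phi> u \<le> dilation_fun ?\<phi> s * dilation_fun ?\<phi> t"
    if u: "0 < u" "u \<le> min 1 (1 / (s * t))" for u
  proof -
    have stu: "s * (t * u) \<le> 1" using u st0 by (simp add: field_simps)
    have tu: "t * u \<le> 1"
      using st
    proof
      assume a: "1 \<le> s \<and> 1 \<le> t"
      then have "1 * (t * u) \<le> s * (t * u)" using u by (intro mult_right_mono) auto
      then show ?thesis using stu by linarith
    next
      assume a: "0 < s \<and> s \<le> 1 \<and> 0 < t \<and> t \<le> 1"
      then have "t * u \<le> 1 * 1" using u by (intro mult_mono) auto
      then show ?thesis by simp
    qed
    have u1: "u \<le> 1" using u by simp
    have "t * u \<le> 1 / s" "u \<le> 1 / t" using stu tu st0 by (simp_all add: pos_le_divide_eq mult.commute)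
    then have m: "t * u \<le> min 1 (1 / s)" "u \<le> min 1 (1 / t)" using tu u1 by simp_all
    have tu0: "0 < t * u" "0 < s * (t * u)" using st0 u by simp_all
    have 1: "?\<phi> (s * (t * u)) / ?\<phi> (t * u) \<le> dilation_fun ?\<phi> s"
      by (rule dilation_fun_bound[OF st0(1) K tu0(1) m(1)])
    have ratio: "?\<phi> (t * u) / ?\<phi> u \<le> dilation_fun ?\<phi> t"
      by (rule dilation_fun_bound[OF st0(2) K' u(1) m(2)])
    have 2: "0 < ?\<phi> (t * u)" "0 < ?\<phi> u" "0 < ?\<phi> (s * (t * u))"
      using fundamental_fun_pos tu0 tu u u1 stu by simp_all
    have "?\<phi> (s * t * u) / ?\<phi> u = ?\<phi> (s * (t * u)) / ?\<phi> (t * u) * (?\<phi> (t * u) / ?\<phi> u)"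
      using 2 by (simp add: mult.assoc)
    also have "\<dots> \<le> dilation_fun ?\<phi> s * dilation_fun ?\<phi> t"
    proof (rule mult_mono[OF 1 ratio])
      have "0 < ?\<phi> (s * (t * u)) / ?\<phi> (t * u)" using 2 by simp
      then show "0 \<le> dilation_fun ?\<phi> s" using 1 by linarith
    qed (use 2 in simp)
    finally show ?thesis .
  qed
  moreover have "\<exists>u>0. u \<le> min 1 (1 / (s * t))"
    using st0 by (intro exI[where x="min 1 (1 / (s * t))"]) auto
  ultimately show ?thesis
    unfolding dilation_fun_def[of _ "s * t"] by (intro cSup_least) blast+
qed

lemma fundamental_fun_shrink:
  assumes "0 < s" "s \<le> min 1 (1 / (1 / 2 ^ n))"
  shows "fundamental_fun N (1 / 2 ^ n * s) \<le> 1 * fundamental_fun N s"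
proof -
  have "1 / 2 ^ n * s \<le> s" using assms by (intro mult_left_le_one_le) auto
  then show ?thesis using fundamental_fun_mono[of "1 / 2 ^ n * s" s] assms by simp
qed

lemma fundamental_fun_grow:
  assumes "0 < s" "s \<le> min 1 (1 / 2 ^ n)"
  shows "fundamental_fun N (2 ^ n * s) \<le> 2 ^ n * fundamental_fun N s"
proof -
  have "2 ^ n * s \<le> 1" using assms by (simp add: field_simps)
  then show ?thesis using fundamental_fun_multiple[of "2 ^ n" s] assms by simp
qed

lemma lower_dilation_index_bound:
  "2 powr (- lower_dilation_index (fundamental_fun N) * real n)
    \<le> dilation_fun (fundamental_fun N) (1 / 2 ^ n)"
proof -
  let ?\<phi> = "fundamental_fun N"
  have "dilation_fun ?\<phi> (1 / 2 ^ (m + n)) \<le> dilation_fun ?\<phi> (1 / 2 ^ m) * dilation_fun ?\<phi> (1 / 2 ^ n)"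
    for m n
    using dilation_fun_mult[OF _ fundamental_fun_shrink[of _ m] fundamental_fun_shrink[of _ n]]
    by (simp add: power_add)
  moreover have "1 / 2 ^ n \<le> dilation_fun ?\<phi> (1 / 2 ^ n)" for n
  proof -
    have "?\<phi> 1 \<le> 2 ^ n * ?\<phi> (1 / 2 ^ n)" using fundamental_fun_grow[of "1 / 2 ^ n" n] by simp
    then have "1 / 2 ^ n \<le> ?\<phi> (1 / 2 ^ n * 1) / ?\<phi> 1"
      using fundamental_fun_pos[of 1] by (simp add: field_simps)
    also have "\<dots> \<le> dilation_fun ?\<phi> (1 / 2 ^ n)"
      by (rule dilation_fun_bound[OF _ fundamental_fun_shrink]) auto
    finally show ?thesis .
  qed
  ultimately show ?thesis
    using submultiplicative_growth(2)[where h="\<lambda>n. dilation_fun ?\<phi> (1 / 2 ^ n)" and n=n]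
    unfolding lower_dilation_index_def by simp
qed

lemma upper_dilation_index_bound:
  "2 powr (upper_dilation_index (fundamental_fun N) * real n)
    \<le> dilation_fun (fundamental_fun N) (2 ^ n)"
proof -
  let ?\<phi> = "fundamental_fun N"
  have "dilation_fun ?\<phi> (2 ^ (m + n)) \<le> dilation_fun ?\<phi> (2 ^ m) * dilation_fun ?\<phi> (2 ^ n)" for m n
    using dilation_fun_mult[OF _ fundamental_fun_grow[of _ m] fundamental_fun_grow[of _ n]]
    by (simp add: power_add)
  moreover have "1 / 2 ^ n \<le> dilation_fun ?\<phi> (2 ^ n)" for n
  proof -
    have "1 / 2 ^ n \<le> (1::real)" by simp
    also have "1 \<le> ?\<phi> (2 ^ n * (1 / 2 ^ n)) / ?\<phi> (1 / 2 ^ n)"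
      using fundamental_fun_pos[of "1 / 2 ^ n"] fundamental_fun_mono[of "1 / 2 ^ n" 1]
      by (simp add: field_simps)
    also have "\<dots> \<le> dilation_fun ?\<phi> (2 ^ n)"
      by (rule dilation_fun_bound[OF _ fundamental_fun_grow]) auto
    finally show ?thesis .
  qed
  ultimately show ?thesis
    using submultiplicative_growth(2)[where h="\<lambda>n. dilation_fun ?\<phi> (2 ^ n)" and n=n]
    unfolding upper_dilation_index_def by simp
qed

lemma dyadic_bracket:
  fixes r :: real
  assumes "0 < r" "r \<le> 1"
  obtains i where "1 / 2 ^ Suc i < r" "r \<le> 1 / 2 ^ i"
proof -
  obtain n where n: "(1 / 2) ^ n < r" using real_arch_pow_inv[of r "1 / 2"] assms by auto
  define k where "k = (LEAST n. (1 / 2) ^ n < r)"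
  have k: "(1 / 2) ^ k < r" unfolding k_def by (rule LeastI[of _ n]) (rule n)
  have "k \<noteq> 0" using k assms by (cases k) auto
  then obtain i where i: "k = Suc i" by (cases k) auto
  have "\<not> (1 / 2) ^ i < r" using not_less_Least[of i "\<lambda>n. (1 / 2) ^ n < r"] i by (simp add: k_def)
  then show ?thesis using that[of i] k i by (simp add: power_divide)
qed

text \<open>The quotients in the dilation function are taken at arbitrary points. Rounding the points to
  powers of \<open>1 / 2\<close> changes the fundamental function by a factor of at most \<open>2\<close>; another factor
  \<open>2\<close> pays for choosing a point at which the supremum is almost attained.\<close>

lemma lower_dilation_window:
  assumes "lower_dilation_index (fundamental_fun N) \<le> \<theta>"
  shows "\<exists>i. 2 powr (- \<theta> * real n) / 4 * fundamental_fun N (1 / 2 ^ i) \<le> fundamental_fun N (1 / 2 ^ (i + n))"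
proof -
  let ?\<phi> = "fundamental_fun N"
  let ?R = "2 powr (- \<theta> * real n)"
  have "?R \<le> 2 powr (- lower_dilation_index ?\<phi> * real n)"
    using assms by (simp add: mult_right_mono)
  also note lower_dilation_index_bound[of n]
  finally have "?R \<le> dilation_fun ?\<phi> (1 / 2 ^ n)" .
  moreover have "0 < ?R" by simp
  ultimately have "?R / 2 < dilation_fun ?\<phi> (1 / 2 ^ n)" by linarith
  moreover have "{?\<phi> (1 / 2 ^ n * s) / ?\<phi> s | s. 0 < s \<and> s \<le> min 1 (1 / (1 / 2 ^ n))} \<noteq> {}"
  proof -
    have "0 < (1::real) \<and> 1 \<le> min 1 (1 / (1 / (2::real) ^ n))" by simp
    then show ?thesis by blast
  qed
  ultimately obtain s where s: "0 < s" "s \<le> min 1 (1 / (1 / 2 ^ n))" "?R / 2 < ?\<phi> (1 / 2 ^ n * s) / ?\<phi> s"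
    unfolding dilation_fun_def using less_cSupD[of "{?\<phi> (1 / 2 ^ n * s) / ?\<phi> s | s. 0 < s \<and> s \<le> min 1 (1 / (1 / 2 ^ n))}" "?R / 2"]
    by blast
  then have s1: "s \<le> 1" by simp
  obtain i where i: "1 / 2 ^ Suc i < s" "s \<le> 1 / 2 ^ i" by (rule dyadic_bracket[OF s(1) s1])
  have "?\<phi> (1 / 2 ^ i) \<le> 2 * ?\<phi> (1 / 2 ^ Suc i)"
    using fundamental_fun_grow[of "1 / 2 ^ Suc i" 1] by (simp add: field_simps)
  also have "\<dots> \<le> 2 * ?\<phi> s" using i s1 by (intro mult_left_mono fundamental_fun_mono) auto
  finally have "?R / 4 * ?\<phi> (1 / 2 ^ i) \<le> ?R / 4 * (2 * ?\<phi> s)" by (intro mult_left_mono) auto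
  also have "\<dots> \<le> ?\<phi> (1 / 2 ^ n * s)" using s(3) fundamental_fun_pos[OF s(1) s1] by (simp add: field_simps)
  also have "\<dots> \<le> ?\<phi> (1 / 2 ^ (i + n))"
  proof (rule fundamental_fun_mono)
    show "1 / 2 ^ n * s \<le> 1 / 2 ^ (i + n)" using i by (simp add: power_add field_simps)
  qed simp
  finally show ?thesis by blast
qed

lemma upper_dilation_window:
  assumes "\<theta> \<le> upper_dilation_index (fundamental_fun N)"
  shows "\<exists>i. 2 powr (\<theta> * real n) / 4 * fundamental_fun N (1 / 2 ^ (i + n)) \<le> fundamental_fun N (1 / 2 ^ i)"
proof -
  let ?\<phi> = "fundamental_fun N"
  let ?R = "2 powr (\<theta> * real n)"
  have "?R \<le> 2 powr (upper_dilation_index ?\<phi> * real n)"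
    using assms by (simp add: mult_right_mono)
  also note upper_dilation_index_bound[of n]
  finally have "?R \<le> dilation_fun ?\<phi> (2 ^ n)" .
  moreover have "0 < ?R" by simp
  ultimately have "?R / 2 < dilation_fun ?\<phi> (2 ^ n)" by linarith
  moreover have "{?\<phi> (2 ^ n * s) / ?\<phi> s | s. 0 < s \<and> s \<le> min 1 (1 / 2 ^ n)} \<noteq> {}"
  proof -
    have "0 < 1 / (2::real) ^ n \<and> 1 / 2 ^ n \<le> min 1 (1 / (2::real) ^ n)" by simp
    then show ?thesis by blast
  qed
  ultimately obtain s where s: "0 < s" "s \<le> min 1 (1 / 2 ^ n)" "?R / 2 < ?\<phi> (2 ^ n * s) / ?\<phi> s"
    unfolding dilation_fun_def using less_cSupD[of "{?\<phi> (2 ^ n * s) / ?\<phi> s | s. 0 < s \<and> s \<le> min 1 (1 / 2 ^ n)}" "?R / 2"]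
    by blast
  have s1: "s \<le> 1" by (rule order_trans[OF s(2)]) simp
  define r where "r = 2 ^ n * s"
  have r: "0 < r" "r \<le> 1" "s = r / 2 ^ n" using s by (auto simp: r_def field_simps)
  obtain i where i: "1 / 2 ^ Suc i < r" "r \<le> 1 / 2 ^ i" by (rule dyadic_bracket[OF r(1,2)])
  have e: "2 * (1 / 2 ^ (i + n + 1)) = 1 / (2::real) ^ (i + n)" by simp
  have "?\<phi> (1 / 2 ^ (i + n)) \<le> 2 * ?\<phi> (1 / 2 ^ (i + n + 1))"
    using fundamental_fun_grow[of "1 / 2 ^ (i + n + 1)" 1] unfolding power_one_right e by simp
  also have "\<dots> \<le> 2 * ?\<phi> s"
  proof (intro mult_left_mono fundamental_fun_mono)
    have "1 / 2 ^ Suc i / 2 ^ n \<le> r / 2 ^ n" using i by (intro divide_right_mono) auto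
    then show "1 / 2 ^ (i + n + 1) \<le> s" using r(3) by (simp add: power_add)
  qed (use s1 in simp_all)
  finally have "?R / 4 * ?\<phi> (1 / 2 ^ (i + n)) \<le> ?R / 4 * (2 * ?\<phi> s)" by (intro mult_left_mono) auto
  also have "\<dots> \<le> ?\<phi> r" using s(3) fundamental_fun_pos[OF s(1) s1] by (simp add: field_simps r_def)
  also have "\<dots> \<le> ?\<phi> (1 / 2 ^ i)" using i by (intro fundamental_fun_mono) auto
  finally show ?thesis by blast
qed

end

text \<open>Long stretches of slow decay and of fast decay exist, but perhaps not where they are wanted.
  Dropping the first \<open>P\<close> steps of a slow stretch moves it beyond \<open>P\<close>, and dropping the first
  \<open>J\<close> steps of a fast stretch moves it beyond the end \<open>J\<close> of the slow one. By monotonicity and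
  doubling this costs factors that depend on \<open>P\<close> and \<open>J\<close> only, which the gain of \<open>\<delta>\<close> per step
  outweighs on a stretch that is long enough.\<close>

lemma separating_windows:
  fixes w :: "nat \<Rightarrow> real"
  assumes pos: "\<And>i. 0 < w i" and dec: "\<And>i j. i \<le> j \<Longrightarrow> w j \<le> w i"
    and doubling: "\<And>i j. w i \<le> 2 ^ j * w (i + j)"
    and lower: "\<And>n. \<exists>i. 2 powr (- \<theta> * real n) / 4 * w i \<le> w (i + n)"
    and upper: "\<And>n. \<exists>i. 2 powr (\<theta> * real n) / 4 * w (i + n) \<le> w i"
    and \<delta>: "0 < \<delta>" and e: "0 < e"
  obtains A J K B where "P \<le> A" "A < J" "J \<le> K" "K < B"
    and "w A * 2 powr ((\<theta> + \<delta>) * real A) \<le> e * (w J * 2 powr ((\<theta> + \<delta>) * real J))"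
    and "w B * 2 powr ((\<theta> - \<delta>) * real B) \<le> e * (w K * 2 powr ((\<theta> - \<delta>) * real K))"
proof -
  define l where "l = log 2 (e / 4)"
  have e4: "e / 4 = 2 powr l" unfolding l_def by (rule powr_log_cancel[symmetric]) (use e in auto)
  obtain n :: nat where n: "max (real P) (((\<theta> + \<delta>) * real P - l) / \<delta>) < real n"
    using reals_Archimedean2 by blast
  then have nP: "P < n" and n\<delta>: "(\<theta> + \<delta>) * real P - l \<le> \<delta> * real n"
    using \<delta> by (auto simp: field_simps)
  obtain i where i: "2 powr (- \<theta> * real n) / 4 * w i \<le> w (i + n)" using lower by blast
  define A J where "A = i + P" and "J = i + n"
  have "w A * 2 powr ((\<theta> + \<delta>) * real A) \<le> w i * 2 powr ((\<theta> + \<delta>) * real A)"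
    by (intro mult_right_mono dec) (auto simp: A_def)
  also have "\<dots> \<le> w i * 2 powr (l - \<theta> * real n + (\<theta> + \<delta>) * real J)"
  proof (intro mult_left_mono)
    have "(\<theta> + \<delta>) * real A \<le> l - \<theta> * real n + (\<theta> + \<delta>) * real J"
      using n\<delta> by (simp add: A_def J_def algebra_simps)
    then show "2 powr ((\<theta> + \<delta>) * real A) \<le> 2 powr (l - \<theta> * real n + (\<theta> + \<delta>) * real J)" by simp
  qed (use pos[of i] in simp)
  also have "\<dots> = e * ((2 powr (- \<theta> * real n) / 4 * w i) * 2 powr ((\<theta> + \<delta>) * real J))"
    using e4 by (simp add: powr_add powr_diff powr_minus field_simps)
  also have "\<dots> \<le> e * (w J * 2 powr ((\<theta> + \<delta>) * real J))"
    using i e by (intro mult_left_mono mult_right_mono) (auto simp: J_def)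
  finally have 1: "w A * 2 powr ((\<theta> + \<delta>) * real A) \<le> e * (w J * 2 powr ((\<theta> + \<delta>) * real J))" .
  obtain m :: nat where m: "max (real J) ((real J - (\<theta> - \<delta>) * real J - l) / \<delta>) < real m"
    using reals_Archimedean2 by blast
  then have mJ: "J < m" and m\<delta>: "real J - (\<theta> - \<delta>) * real J - l \<le> \<delta> * real m"
    using \<delta> by (auto simp: field_simps)
  obtain k where k: "2 powr (\<theta> * real m) / 4 * w (k + m) \<le> w k" using upper by blast
  define K B where "K = k + J" and "B = k + m"
  have "w B * 2 powr ((\<theta> - \<delta>) * real B) \<le> w B * 2 powr (l - real J + \<theta> * real m + (\<theta> - \<delta>) * real K)"
  proof (intro mult_left_mono)
    have "(\<theta> - \<delta>) * real B \<le> l - real J + \<theta> * real m + (\<theta> - \<delta>) * real K"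
      using m\<delta> by (simp add: K_def B_def algebra_simps)
    then show "2 powr ((\<theta> - \<delta>) * real B) \<le> 2 powr (l - real J + \<theta> * real m + (\<theta> - \<delta>) * real K)"
      by simp
  qed (use pos[of B] in simp)
  also have "\<dots> = e * ((2 powr (\<theta> * real m) / 4 * w B) / 2 ^ J * 2 powr ((\<theta> - \<delta>) * real K))"
    using e4 by (simp add: powr_add powr_diff powr_realpow field_simps)
  also have "\<dots> \<le> e * (w K * 2 powr ((\<theta> - \<delta>) * real K))"
  proof (intro mult_left_mono mult_right_mono)
    have "2 powr (\<theta> * real m) / 4 * w B \<le> 2 ^ J * w K"
      using k doubling[of k J] by (simp add: B_def K_def)
    then show "2 powr (\<theta> * real m) / 4 * w B / 2 ^ J \<le> w K" by (simp add: field_simps)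
  qed (use e in auto)
  finally have 2: "w B * 2 powr ((\<theta> - \<delta>) * real B) \<le> e * (w K * 2 powr ((\<theta> - \<delta>) * real K))" .
  show thesis
    by (rule that[of A J K B]) (use 1 2 nP mJ in \<open>auto simp: A_def J_def K_def B_def\<close>)
qed

section \<open>Almost homogeneous profiles\<close>

definition window :: "(real \<Rightarrow> real) \<Rightarrow> real \<Rightarrow> real \<Rightarrow> real \<Rightarrow> real" where
  "window g l r t = (if l < t \<and> t \<le> r then g t else 0)"

text \<open>A decreasing profile that a contraction of factor \<open>s\<close> multiplies by about \<open>s powr \<theta>\<close>, with
  an error of \<open>\<delta>\<close> in the exponent. For \<open>\<delta> = 0\<close> it is a multiple of \<open>\<lambda>t. t powr (- \<theta>)\<close>.\<close>

locale almost_homogeneous = ri_space +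
  fixes g :: "real \<Rightarrow> real" and \<theta> \<delta> :: real
  assumes g_measurable [measurable]: "g \<in> borel_measurable borel"
    and g_pos: "0 < t \<Longrightarrow> 0 < g t"
    and g_antimono: "0 < s \<Longrightarrow> s \<le> t \<Longrightarrow> g t \<le> g s"
    and g_lower: "0 < t \<Longrightarrow> 0 < s \<Longrightarrow> s \<le> 1 \<Longrightarrow> s powr (\<theta> + \<delta>) * g t \<le> g (t / s)"
    and g_upper: "0 < t \<Longrightarrow> 0 < s \<Longrightarrow> s \<le> 1 \<Longrightarrow> g (t / s) \<le> s powr (\<theta> - \<delta>) * g t"
    and \<delta>_nonneg: "0 \<le> \<delta>" and \<theta>_pos: "0 < \<theta>"
begin

lemma level_set_lmeasurable: "{t. l < t \<and> t \<le> r \<and> \<tau> < k * g t} \<in> lmeasurable"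
proof (rule bounded_set_imp_lmeasurable)
  show "bounded {t. l < t \<and> t \<le> r \<and> \<tau> < k * g t}"
    by (rule bounded_subset[of "{l..r}"]) auto
  have "{t \<in> space borel. l < t \<and> t \<le> r \<and> \<tau> < k * g t} \<in> sets borel" by measurable
  then show "{t. l < t \<and> t \<le> r \<and> \<tau> < k * g t} \<in> sets lebesgue" by simp
qed

lemma copy_measurable: "(\<lambda>t. window g l r (t - d)) \<in> borel_measurable unit_leb"
proof -
  have "(\<lambda>t. window g l r (t - d)) \<in> borel_measurable borel"
    unfolding window_def by measurable
  then have "(\<lambda>t. window g l r (t - d)) \<in> borel_measurable lebesgue"
    by (intro measurable_completion) simp
  then show ?thesis by (rule measurable_restrict_space1)
qed

lemma copy_mem:
  assumes "0 < l"
  shows "(\<lambda>t. window g l r (t - d)) \<in> X"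
proof (rule norm_mono(1)[OF scale_mem[OF unit_mem, of "g l"] copy_measurable])
  fix s :: real assume "s \<in> {0..1}"
  moreover have "\<bar>window g l r (s - d)\<bar> \<le> g l"
    using g_pos[of l] g_pos[of "s - d"] g_antimono[of l "s - d"] assms by (auto simp: window_def)
  ultimately show "\<bar>window g l r (s - d)\<bar> \<le> \<bar>g l * indicator {0..1} s\<bar>" by simp
qed

lemma window_mem: "0 < l \<Longrightarrow> window g l r \<in> X"
  using copy_mem[of l r 0] by simp

lemma distribution_fun_copy:
  assumes l: "0 \<le> l" and d: "0 \<le> d" "d + r \<le> 1" and \<tau>: "0 \<le> \<tau>"
  shows "distribution_fun (\<lambda>t. k * window g l r (t - d)) \<tau>
    = measure lebesgue {t. l < t \<and> t \<le> r \<and> \<tau> < \<bar>k\<bar> * g t}"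
proof -
  have "{t \<in> {0<..1}. \<bar>k * window g l r (t - d)\<bar> > \<tau>}
    = (\<lambda>u. d + u) ` {t. l < t \<and> t \<le> r \<and> \<tau> < \<bar>k\<bar> * g t}" (is "?A = ?B")
  proof (intro equalityI subsetI)
    fix t assume t: "t \<in> ?A"
    then have w: "l < t - d" "t - d \<le> r" "\<bar>k * g (t - d)\<bar> > \<tau>"
      using \<tau> by (auto simp: window_def split: if_splits)
    then have "\<tau> < \<bar>k\<bar> * g (t - d)" using g_pos[of "t - d"] l by (simp add: abs_mult)
    then show "t \<in> ?B" using w by (intro image_eqI[where x="t - d"]) auto
  next
    fix t assume "t \<in> ?B"
    then obtain u where u: "t = d + u" "l < u" "u \<le> r" "\<tau> < \<bar>k\<bar> * g u" by auto
    moreover have "0 < g u" using g_pos u l by simp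
    ultimately have "t \<in> {0<..1}" "window g l r (t - d) = g u" "\<tau> < \<bar>k * g u\<bar>"
      using l d by (auto simp: window_def abs_mult)
    then show "t \<in> ?A" by simp
  qed
  then show ?thesis by (simp add: distribution_fun_half_open measure_translation)
qed

lemma distribution_fun_window:
  assumes "0 \<le> l" "r \<le> 1" "0 \<le> \<tau>" "0 \<le> k"
  shows "distribution_fun (\<lambda>t. k * window g l r t) \<tau>
    = measure lebesgue {t. l < t \<and> t \<le> r \<and> \<tau> < k * g t}"
  using distribution_fun_copy[of l 0 r \<tau> k] assms by simp

lemma measure_scaled:
  assumes "0 < s"
  shows "measure lebesgue ((\<lambda>u. s * u) ` A) = s * measure lebesgue A"
  using measure_lebesgue_affine[of s 0 A] assms by simp

lemma scaled_lmeasurable: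
  fixes s :: real
  assumes A: "A \<in> lmeasurable" and s: "0 < s"
  shows "(\<lambda>u. s * u) ` A \<in> lmeasurable"
proof (rule fmeasurableI)
  have "(\<lambda>u. s * u) ` A = (*\<^sub>R) (1 / s) -` A \<inter> space lebesgue"
    using s by (auto intro!: image_eqI[where x="_ / s"])
  also have "\<dots> \<in> sets lebesgue"
    by (rule measurable_sets[OF lebesgue_measurable_scaling]) (use A in auto)
  finally show "(\<lambda>u. s * u) ` A \<in> sets lebesgue" .
  have "emeasure lebesgue ((\<lambda>u. s * u) ` A) = ennreal s * emeasure lebesgue A"
    using emeasure_lebesgue_affine[of s 0 A] s by simp
  then show "emeasure lebesgue ((\<lambda>u. s * u) ` A) < \<infinity>"
    using fmeasurableD2[OF A] by (simp add: ennreal_mult_less_top less_top)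
qed

text \<open>In both of the next two estimates the substitution \<open>t = s * u\<close> turns \<open>s powr \<theta>\<close> times the
  profile into the profile itself, up to a factor between \<open>\<eta> powr \<delta>\<close> and \<open>\<eta> powr (- \<delta>)\<close>. It
  multiplies all measures by \<open>s\<close> and moves each edge of the window by a factor of at most
  \<open>1 / \<eta>\<close>.\<close>

lemma level_measure_upper:
  assumes b: "0 < b" and \<eta>: "0 < \<eta>" "\<eta> \<le> s" "s \<le> 1" and a: "a / \<eta> \<le> 1" and \<tau>: "0 \<le> \<tau>"
  shows "measure lebesgue {t. b < t \<and> t \<le> a \<and> \<tau> < s powr \<theta> * g t}
    \<le> s * distribution_fun (\<lambda>t. \<eta> powr (- \<delta>) * window g b (a / \<eta>) t) \<tau>"
proof -
  let ?U = "{u. b < u \<and> u \<le> a / \<eta> \<and> \<tau> < \<eta> powr (- \<delta>) * g u}"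
  have s: "0 < s" using \<eta> by simp
  have "{t. b < t \<and> t \<le> a \<and> \<tau> < s powr \<theta> * g t} \<subseteq> (\<lambda>u. s * u) ` ?U"
  proof
    fix t assume "t \<in> {t. b < t \<and> t \<le> a \<and> \<tau> < s powr \<theta> * g t}"
    then have t: "b < t" "t \<le> a" "\<tau> < s powr \<theta> * g t" by auto
    have t0: "0 < t" using t b by simp
    have "s * t \<le> t" using \<eta> s t0 by (intro mult_left_le_one_le) auto
    then have "t \<le> t / s" using s by (simp add: field_simps)
    have "t / s \<le> a / \<eta>" using t t0 \<eta> by (intro frac_le) auto
    have "s powr \<theta> * g t = s powr (- \<delta>) * (s powr (\<theta> + \<delta>) * g t)"
      by (simp add: mult.assoc[symmetric] powr_add[symmetric])
    also have "\<dots> \<le> s powr (- \<delta>) * g (t / s)" using g_lower[OF t0 s \<eta>(3)] by (intro mult_left_mono) auto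
    also have "\<dots> \<le> \<eta> powr (- \<delta>) * g (t / s)"
      using \<eta> \<delta>_nonneg s t0 g_pos[of "t / s"] by (intro mult_right_mono powr_mono2') auto
    finally have "\<tau> < \<eta> powr (- \<delta>) * g (t / s)" using t by simp
    then show "t \<in> (\<lambda>u. s * u) ` ?U"
      using s t \<open>t \<le> t / s\<close> \<open>t / s \<le> a / \<eta>\<close> by (intro image_eqI[where x="t / s"]) auto
  qed
  then have "measure lebesgue {t. b < t \<and> t \<le> a \<and> \<tau> < s powr \<theta> * g t} \<le> measure lebesgue ((\<lambda>u. s * u) ` ?U)"
    by (intro measure_mono_fmeasurable scaled_lmeasurable level_set_lmeasurable fmeasurableD s)
  also have "\<dots> = s * distribution_fun (\<lambda>t. \<eta> powr (- \<delta>) * window g b (a / \<eta>) t) \<tau>"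
    using distribution_fun_window[of b "a / \<eta>" \<tau> "\<eta> powr (- \<delta>)"] measure_scaled[OF s] a b \<tau> by simp
  finally show ?thesis .
qed

lemma level_measure_lower:
  assumes b: "0 < b" and \<eta>: "0 < \<eta>" "\<eta> \<le> s" "s \<le> 1" and a: "a \<le> 1" and \<tau>: "0 \<le> \<tau>"
  shows "s * distribution_fun (\<lambda>t. \<eta> powr \<delta> * window g (b / \<eta>) a t) \<tau>
    \<le> measure lebesgue {t. b < t \<and> t \<le> a \<and> \<tau> < s powr \<theta> * g t}"
proof -
  let ?U = "{u. b / \<eta> < u \<and> u \<le> a \<and> \<tau> < \<eta> powr \<delta> * g u}"
  have s: "0 < s" using \<eta> by simp
  have "(\<lambda>u. s * u) ` ?U \<subseteq> {t. b < t \<and> t \<le> a \<and> \<tau> < s powr \<theta> * g t}"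
  proof
    fix t assume "t \<in> (\<lambda>u. s * u) ` ?U"
    then obtain u where u: "t = s * u" "b / \<eta> < u" "u \<le> a" "\<tau> < \<eta> powr \<delta> * g u" by auto
    have "0 < b / \<eta>" using b \<eta> by simp
    then have u0: "0 < u" using u by linarith
    have t0: "0 < t" using u0 s u by simp
    have "b < \<eta> * u" using u \<eta> by (simp add: field_simps)
    also have "\<dots> \<le> s * u" using \<eta> u0 by (intro mult_right_mono) auto
    finally have "b < t" using u by simp
    have "t \<le> u" unfolding u(1) using \<eta> s u0 by (intro mult_left_le_one_le) auto
    have "\<eta> powr \<delta> * g u \<le> s powr \<delta> * g u"
      using \<eta> \<delta>_nonneg g_pos[OF u0] by (intro mult_right_mono powr_mono2) auto
    also have "\<dots> \<le> s powr \<delta> * (s powr (\<theta> - \<delta>) * g t)"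
      using g_upper[OF t0 s \<eta>(3)] u(1) s by (intro mult_left_mono) auto
    also have "\<dots> = s powr \<theta> * g t" by (simp add: mult.assoc[symmetric] powr_add[symmetric])
    finally show "t \<in> {t. b < t \<and> t \<le> a \<and> \<tau> < s powr \<theta> * g t}"
      using u \<open>b < t\<close> \<open>t \<le> u\<close> by auto
  qed
  then have "measure lebesgue ((\<lambda>u. s * u) ` ?U) \<le> measure lebesgue {t. b < t \<and> t \<le> a \<and> \<tau> < s powr \<theta> * g t}"
    by (intro measure_mono_fmeasurable scaled_lmeasurable level_set_lmeasurable fmeasurableD s)
  then show ?thesis
    using distribution_fun_window[of "b / \<eta>" a \<tau> "\<eta> powr \<delta>"] measure_scaled[OF s] a b \<tau> \<eta> by simp
qed

text \<open>The strip at the edge is \<open>2 ^ m - 1\<close> times as long as its distance \<open>r\<close> from \<open>0\<close>, and the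
  profile is largest at its left end.\<close>

lemma window_edge_norm:
  assumes "0 < r" "2 ^ m * r \<le> 1"
  shows "N (window g r (2 ^ m * r)) \<le> 2 ^ m * (fundamental_fun N r * g r)"
proof -
  let ?I = "indicator {0..2 ^ m * r} :: real \<Rightarrow> real"
  have I: "?I \<in> X" using assms by (intro indicator_mem interval_mem) simp
  have "N (window g r (2 ^ m * r)) \<le> N (\<lambda>s. g r * ?I s)"
  proof (rule norm_mono(2)[OF scale_mem[OF I]])
    show "window g r (2 ^ m * r) \<in> borel_measurable unit_leb" using copy_measurable[of r "2 ^ m * r" 0] by simp
    show "\<bar>window g r (2 ^ m * r) s\<bar> \<le> \<bar>g r * ?I s\<bar>" for s
      using g_pos[of r] g_pos[of s] g_antimono[of r s] assms by (auto simp: window_def indicator_def)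
  qed
  also have "\<dots> = g r * fundamental_fun N (2 ^ m * r)"
    using norm_scale[OF I, of "g r"] g_pos[OF assms(1)] by (simp add: fundamental_fun_def)
  also have "\<dots> \<le> g r * (2 ^ m * fundamental_fun N r)"
    using fundamental_fun_grow[of r m] fundamental_fun_multiple[of "2 ^ m" r] assms g_pos[of r]
    by (intro mult_left_mono) auto
  finally show ?thesis by (simp add: mult_ac)
qed

lemma window_add:
  assumes "0 < l" "0 < u"
  shows "N (window g l r) \<le> N (window g l u) + N (window g u r)"
proof -
  have m: "window g l u \<in> X" "window g u r \<in> X" "window g l r \<in> X" using assms by (auto intro: window_mem)
  have "\<bar>window g l r s\<bar> \<le> \<bar>window g l u s + window g u r s\<bar>" for s
    using g_pos[of s] assms by (auto simp: window_def)
  then have "N (window g l r) \<le> N (\<lambda>s. window g l u s + window g u r s)"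
    by (intro norm_mono(2)[OF add_mem[OF m(1,2)] measurable[OF m(3)]])
  also have "\<dots> \<le> N (window g l u) + N (window g u r)" by (rule norm_triangle[OF m(1,2)])
  finally show ?thesis .
qed

text \<open>The copies of the windowed profile, placed side by side.\<close>

abbreviation copy :: "real \<Rightarrow> real \<Rightarrow> nat \<Rightarrow> real \<Rightarrow> real" where
  "copy b a k t \<equiv> window g b a (t - real (k - 1) * a)"

lemma copy_disjoint:
  assumes "1 \<le> i" "1 \<le> j" "i \<noteq> j" "0 < b"
  shows "copy b a i s = 0 \<or> copy b a j s = 0"
proof (rule ccontr)
  assume "\<not> ?thesis"
  then have "real (i - 1) * a < s" "s \<le> real (i - 1) * a + a" "real (j - 1) * a < s" "s \<le> real (j - 1) * a + a"
    using assms(4) by (auto simp: window_def split: if_splits)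
  then have "i - 1 = j - 1" by (rule grid_interval_unique)
  then show False using assms by simp
qed

lemma copy_position:
  assumes "k \<in> {1..n}" "0 < a" "real n * a \<le> 1"
  shows "0 \<le> real (k - 1) * a" "real (k - 1) * a + a \<le> 1"
proof -
  have "real (k - 1) * a + a = real k * a" using assms(1) by (simp add: of_nat_diff algebra_simps)
  also have "\<dots> \<le> real n * a" using assms by (intro mult_right_mono) auto
  finally show "real (k - 1) * a + a \<le> 1" using assms(3) by simp
qed (use assms in simp)

text \<open>The weights \<open>\<bar>\<alpha> k\<bar> powr (1 / \<theta>)\<close> add up to \<open>1\<close>, so the level measures of the summands
  add up to about those of a single windowed profile. This is how the \<open>\<ell>\<^sup>p\<close> norm with
  \<open>p = 1 / \<theta>\<close> arises.\<close>

lemma combination_norm: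
  fixes \<alpha> :: "nat \<Rightarrow> real"
  assumes ab: "0 < b" "b \<le> a" "real n * a \<le> 1" "a / \<eta> \<le> 1" and \<eta>: "0 < \<eta>" "\<eta> \<le> 1"
    and K: "K \<subseteq> {1..n}" and sum: "(\<Sum>k\<in>K. \<bar>\<alpha> k\<bar> powr (1 / \<theta>)) = 1"
    and low: "\<And>k. k \<in> K \<Longrightarrow> \<eta> \<le> \<bar>\<alpha> k\<bar> powr (1 / \<theta>)"
  shows "N (\<lambda>t. \<Sum>k\<in>K. \<alpha> k * copy b a k t) \<le> \<eta> powr (- \<delta>) * N (window g b (a / \<eta>))"
    and "\<eta> powr \<delta> * N (window g (b / \<eta>) a) \<le> N (\<lambda>t. \<Sum>k\<in>K. \<alpha> k * copy b a k t)"
proof -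
  let ?S = "\<lambda>t. \<Sum>k\<in>K. \<alpha> k * copy b a k t"
  define s where "s k = \<bar>\<alpha> k\<bar> powr (1 / \<theta>)" for k
  have a: "0 < a" using ab by simp
  have fin: "finite K" using K by (rule finite_subset) simp
  have a1: "a \<le> 1"
  proof -
    have "a \<le> \<eta>" using ab(4) \<eta> by (simp add: field_simps)
    then show ?thesis using \<eta>(2) by linarith
  qed
  have s1: "s k \<le> 1" if "k \<in> K" for k
    using member_le_sum[OF that, of s] fin sum by (simp add: s_def)
  have s\<theta>: "s k powr \<theta> = \<bar>\<alpha> k\<bar>" for k using \<theta>_pos by (simp add: s_def powr_powr)
  have xX: "copy b a k \<in> X" for k by (rule copy_mem[OF ab(1)])
  have yX: "(\<lambda>t. \<alpha> k * copy b a k t) \<in> X" for k by (rule scale_mem[OF xX])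
  have SX: "?S \<in> X" using sum_mem_norm[OF fin, of "\<lambda>k t. \<alpha> k * copy b a k t"] yX by simp
  have D: "distribution_fun ?S \<tau> = (\<Sum>k\<in>K. measure lebesgue {t. b < t \<and> t \<le> a \<and> \<tau> < s k powr \<theta> * g t})"
    if \<tau>: "0 \<le> \<tau>" for \<tau>
  proof -
    have "distribution_fun ?S \<tau> = (\<Sum>k\<in>K. distribution_fun (\<lambda>t. \<alpha> k * copy b a k t) \<tau>)"
    proof (rule distribution_fun_sum_disjoint[OF fin measurable[OF yX] _ \<tau>])
      fix i j assume "i \<in> K" "j \<in> K" "i \<noteq> j"
      then have "copy b a i s = 0 \<or> copy b a j s = 0" for s
        using K ab by (intro copy_disjoint) auto
      then show "AE s in unit_leb. \<alpha> i * copy b a i s = 0 \<or> \<alpha> j * copy b a j s = 0"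
        by (intro AE_I2) auto
    qed
    also have "\<dots> = (\<Sum>k\<in>K. measure lebesgue {t. b < t \<and> t \<le> a \<and> \<tau> < s k powr \<theta> * g t})"
      unfolding s\<theta>
    proof (intro sum.cong refl distribution_fun_copy)
      fix k assume "k \<in> K"
      then have "k \<in> {1..n}" using K by auto
      from copy_position[OF this a ab(3)] show "0 \<le> real (k - 1) * a" "real (k - 1) * a + a \<le> 1" .
    qed (use ab \<tau> in auto)
    finally show ?thesis .
  qed
  have wX: "window g b (a / \<eta>) \<in> X" "window g (b / \<eta>) a \<in> X" using ab \<eta> by (auto intro: window_mem)
  have "distribution_fun ?S \<tau> \<le> distribution_fun (\<lambda>t. \<eta> powr (- \<delta>) * window g b (a / \<eta>) t) \<tau>" (is "_ \<le> ?D")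
    if \<tau>: "\<tau> > 0" for \<tau>
  proof -
    have "distribution_fun ?S \<tau> \<le> (\<Sum>k\<in>K. s k * ?D)"
      unfolding D[OF less_imp_le[OF \<tau>]]
    proof (rule sum_mono)
      fix k assume "k \<in> K"
      then show "measure lebesgue {t. b < t \<and> t \<le> a \<and> \<tau> < s k powr \<theta> * g t} \<le> s k * ?D"
        using low s1 \<tau> by (intro level_measure_upper ab \<eta>) (auto simp: s_def)
    qed
    also have "\<dots> = ?D" using sum by (simp add: sum_distrib_right[symmetric] s_def)
    finally show ?thesis .
  qed
  then have "N ?S \<le> N (\<lambda>t. \<eta> powr (- \<delta>) * window g b (a / \<eta>) t)"
    using norm_le_of_distribution(2)[OF scale_mem[OF wX(1)] measurable[OF SX]] by simp
  then show "N ?S \<le> \<eta> powr (- \<delta>) * N (window g b (a / \<eta>))"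
    using norm_scale[OF wX(1)] by simp
  have "distribution_fun (\<lambda>t. \<eta> powr \<delta> * window g (b / \<eta>) a t) \<tau> \<le> distribution_fun ?S \<tau>" (is "?D \<le> _")
    if \<tau>: "\<tau> > 0" for \<tau>
  proof -
    have "?D = (\<Sum>k\<in>K. s k * ?D)" using sum by (simp add: sum_distrib_right[symmetric] s_def)
    also have "\<dots> \<le> distribution_fun ?S \<tau>"
      unfolding D[OF less_imp_le[OF \<tau>]]
    proof (rule sum_mono)
      fix k assume "k \<in> K"
      then show "s k * ?D \<le> measure lebesgue {t. b < t \<and> t \<le> a \<and> \<tau> < s k powr \<theta> * g t}"
        using low s1 \<tau> by (intro level_measure_lower ab a1 \<eta>) (auto simp: s_def)
    qed
    finally show ?thesis .
  qed
  then have "N (\<lambda>t. \<eta> powr \<delta> * window g (b / \<eta>) a t) \<le> N ?S"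
    using norm_le_of_distribution(2)[OF SX measurable[OF scale_mem[OF wX(2)]]] by simp
  then show "\<eta> powr \<delta> * N (window g (b / \<eta>) a) \<le> N ?S"
    using norm_scale[OF wX(2)] by simp
qed

text \<open>Coefficients with small \<open>\<bar>a k\<bar> powr p\<close> carry little of the norm and are split off, after which
  the rest is normalized again. The edges of the window contribute little by hypothesis.\<close>

lemma copies_almost_isometric:
  fixes \<alpha> :: "nat \<Rightarrow> real"
  assumes ab: "0 < b" "b \<le> a" "real n * a \<le> 1" "2 ^ m * a \<le> 1"
    and \<gamma>: "0 < \<gamma>" "\<gamma> < 1" and \<theta>1: "\<theta> \<le> 1"
    and edge_a: "2 ^ m * (fundamental_fun N a * g a) \<le> \<gamma> * N (window g b a)"
    and edge_b: "2 ^ m * (fundamental_fun N b * g b) \<le> \<gamma> * N (window g b a)"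
    and small: "real n * (1 / 2 ^ m) powr \<theta> \<le> \<gamma>" and flat: "(2 ^ m) powr \<delta> \<le> 1 + \<gamma>"
    and sum: "(\<Sum>k=1..n. \<bar>\<alpha> k\<bar> powr (1 / \<theta>)) = 1"
  shows "(1 - \<gamma>) ^ 3 * N (window g b a) \<le> N (\<lambda>t. \<Sum>k=1..n. \<alpha> k * copy b a k t)"
    and "N (\<lambda>t. \<Sum>k=1..n. \<alpha> k * copy b a k t) \<le> (1 + \<gamma>) ^ 3 * N (window g b a)"
proof -
  let ?F = "N (window g b a)"
  define \<eta> :: real where "\<eta> = 1 / 2 ^ m"
  have \<eta>: "0 < \<eta>" "\<eta> \<le> 1" by (simp_all add: \<eta>_def)
  have a: "0 < a" using ab by simp
  have div: "x / \<eta> = 2 ^ m * x" for x by (simp add: \<eta>_def)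
  define s where "s k = \<bar>\<alpha> k\<bar> powr (1 / \<theta>)" for k
  have s\<theta>: "s k powr \<theta> = \<bar>\<alpha> k\<bar>" for k using \<theta>_pos by (simp add: s_def powr_powr)
  have s0: "0 \<le> s k" for k by (simp add: s_def)
  define K where "K = {k \<in> {1..n}. \<eta> \<le> s k}"
  define K' where "K' = {k \<in> {1..n}. s k < \<eta>}"
  have KK': "K \<union> K' = {1..n}" "K \<inter> K' = {}" "finite K" "finite K'" "K \<subseteq> {1..n}" "K' \<subseteq> {1..n}"
    by (auto simp: K_def K'_def)
  have split: "(\<Sum>k=1..n. f k) = (\<Sum>k\<in>K. f k) + (\<Sum>k\<in>K'. f k)" for f :: "nat \<Rightarrow> real"
    using sum.union_disjoint[OF KK'(3,4,2), of f] by (simp add: KK'(1))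
  define \<sigma> where "\<sigma> = (\<Sum>k\<in>K. s k)"
  have cardK': "real (card K') \<le> real n" using card_mono[of "{1..n}" K'] KK' by simp
  have \<eta>\<theta>: "\<eta> \<le> \<eta> powr \<theta>"
  proof -
    have "\<eta> powr 1 \<le> \<eta> powr \<theta>" using \<eta> \<theta>1 by (intro powr_mono') auto
    then show ?thesis using \<eta> by simp
  qed
  have "(\<Sum>k\<in>K'. s k) \<le> (\<Sum>k\<in>K'. \<eta>)" by (intro sum_mono) (auto simp: K'_def)
  also have "\<dots> \<le> real n * \<eta> powr \<theta>" using cardK' \<eta> \<eta>\<theta> by (simp add: mult_mono)
  also have "\<dots> \<le> \<gamma>" using small by (simp add: \<eta>_def)
  finally have "(\<Sum>k\<in>K'. s k) \<le> \<gamma>" .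
  moreover have "\<sigma> + (\<Sum>k\<in>K'. s k) = 1" using sum split[of s] by (simp add: \<sigma>_def s_def)
  moreover have "0 \<le> (\<Sum>k\<in>K'. s k)" by (intro sum_nonneg s0)
  ultimately have \<sigma>: "1 - \<gamma> \<le> \<sigma>" "\<sigma> \<le> 1" by auto
  then have \<sigma>0: "0 < \<sigma>" using \<gamma> by simp
  define \<rho> where "\<rho> = \<sigma> powr \<theta>"
  have \<rho>: "0 < \<rho>" "\<rho> \<le> 1" using \<sigma>0 \<sigma> \<theta>_pos by (auto simp: \<rho>_def powr_le1)
  have \<rho>_low: "1 - \<gamma> \<le> \<rho>"
  proof -
    have "\<sigma> powr 1 \<le> \<sigma> powr \<theta>" using \<sigma>0 \<sigma> \<theta>1 by (intro powr_mono') auto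
    then show ?thesis using \<sigma>0 \<sigma> by (simp add: \<rho>_def)
  qed
  have norm_eq: "\<bar>\<alpha> k / \<rho>\<bar> powr (1 / \<theta>) = s k / \<sigma>" for k
    using \<rho> \<sigma>0 \<theta>_pos by (simp add: s_def powr_divide \<rho>_def powr_powr)
  have sumK: "(\<Sum>k\<in>K. \<bar>\<alpha> k / \<rho>\<bar> powr (1 / \<theta>)) = 1"
    unfolding norm_eq using \<sigma>0 by (simp add: sum_divide_distrib[symmetric] \<sigma>_def[symmetric])
  have lowK: "\<eta> \<le> \<bar>\<alpha> k / \<rho>\<bar> powr (1 / \<theta>)" if "k \<in> K" for k
  proof -
    have "s k \<le> s k / \<sigma>" using \<sigma>0 mult_left_le_one_le[OF s0[of k] _ \<sigma>(2)] by (simp add: pos_le_divide_eq mult.commute)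
    then show ?thesis unfolding norm_eq using that by (simp add: K_def)
  qed
  have xX: "copy b a k \<in> X" for k by (rule copy_mem[OF ab(1)])
  have yX: "(\<lambda>t. c k * copy b a k t) \<in> X" for k and c :: "nat \<Rightarrow> real" by (rule scale_mem[OF xX])
  have sumX: "(\<lambda>t. \<Sum>k\<in>L. c k * copy b a k t) \<in> X" if "finite L" for L and c :: "nat \<Rightarrow> real"
    using sum_mem_norm[OF that, of "\<lambda>k t. c k * copy b a k t"] yX by simp
  let ?S = "\<lambda>t. \<Sum>k=1..n. \<alpha> k * copy b a k t"
  let ?T = "\<lambda>t. \<Sum>k\<in>K. \<alpha> k * copy b a k t"
  let ?T' = "\<lambda>t. \<Sum>k\<in>K'. \<alpha> k * copy b a k t"
  let ?R = "\<lambda>t. \<Sum>k\<in>K. \<alpha> k / \<rho> * copy b a k t"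
  have SX: "?S \<in> X" and TX: "?T \<in> X" and TX': "?T' \<in> X" and RX: "?R \<in> X"
    by (rule sumX, simp add: KK')+
  have "?T = (\<lambda>t. \<rho> * ?R t)" using \<rho> by (simp add: sum_distrib_left)
  then have NT: "N ?T = \<rho> * N ?R" using norm_scale[OF RX, of \<rho>] \<rho> by simp
  have F0: "0 \<le> ?F" by (rule norm_nonneg[OF window_mem[OF ab(1)]])
  have \<eta>\<delta>: "\<eta> powr (- \<delta>) \<le> 1 + \<gamma>" "1 - \<gamma> \<le> \<eta> powr \<delta>"
  proof -
    have e: "\<eta> powr \<delta> = inverse ((2 ^ m) powr \<delta>)" by (simp add: \<eta>_def powr_divide field_simps)
    then show "\<eta> powr (- \<delta>) \<le> 1 + \<gamma>" using flat by (simp add: powr_minus)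
    have "1 - \<gamma> \<le> inverse (1 + \<gamma>)" using \<gamma> by (simp add: field_simps)
    also have "\<dots> \<le> inverse ((2 ^ m) powr \<delta>)" using flat by (intro le_imp_inverse_le) auto
    finally show "1 - \<gamma> \<le> \<eta> powr \<delta>" using e by simp
  qed
  note combination = combination_norm[OF ab(1-3) _ \<eta> KK'(5) sumK lowK]
  have upR: "N ?R \<le> (1 + \<gamma>) * ((1 + \<gamma>) * ?F)"
  proof -
    have "N (window g b (2 ^ m * a)) \<le> ?F + N (window g a (2 ^ m * a))"
      by (rule window_add[OF ab(1) a])
    also have "\<dots> \<le> (1 + \<gamma>) * ?F"
      using window_edge_norm[OF a ab(4)] edge_a by (simp add: algebra_simps)
    finally have *: "N (window g b (2 ^ m * a)) \<le> (1 + \<gamma>) * ?F" .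
    have "N ?R \<le> \<eta> powr (- \<delta>) * N (window g b (2 ^ m * a))"
      using combination(1) ab(4) unfolding div by simp
    also have "\<dots> \<le> (1 + \<gamma>) * ((1 + \<gamma>) * ?F)"
      using * \<eta>\<delta> \<gamma> norm_nonneg[OF window_mem[OF ab(1)]] by (intro mult_mono) auto
    finally show ?thesis .
  qed
  have loR: "(1 - \<gamma>) * ((1 - \<gamma>) * ?F) \<le> N ?R"
  proof -
    have b1: "2 ^ m * b \<le> 1" by (rule order_trans[OF mult_left_mono[OF ab(2)] ab(4)]) simp
    have b0: "0 < 2 ^ m * b" using ab by simp
    have "?F \<le> N (window g b (2 ^ m * b)) + N (window g (2 ^ m * b) a)"
      by (rule window_add[OF ab(1) b0])
    then have *: "(1 - \<gamma>) * ?F \<le> N (window g (2 ^ m * b) a)"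
      using window_edge_norm[OF ab(1) b1] edge_b by (simp add: algebra_simps)
    have "(1 - \<gamma>) * ((1 - \<gamma>) * ?F) \<le> \<eta> powr \<delta> * N (window g (2 ^ m * b) a)"
      using * \<eta>\<delta> \<gamma> F0 by (intro mult_mono) auto
    also have "\<dots> \<le> N ?R" using combination(2) ab(4) unfolding div by simp
    finally show ?thesis .
  qed
  have "\<bar>?T t\<bar> \<le> \<bar>?S t\<bar>" for t
  proof (cases "\<exists>k\<in>K. copy b a k t \<noteq> 0")
    case True
    then obtain k where k: "k \<in> K" "copy b a k t \<noteq> 0" by blast
    have "copy b a j t = 0" if "j \<in> K'" for j
      using copy_disjoint[of j k b a t] that k KK' ab(1) by force
    then show ?thesis unfolding split by simp
  qed simp
  then have TS: "N ?T \<le> N ?S" by (intro norm_mono(2)[OF SX measurable[OF TX]])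
  have "(1 - \<gamma>) * ((1 - \<gamma>) * ((1 - \<gamma>) * ?F)) \<le> \<rho> * N ?R"
    using \<rho>_low loR \<gamma> F0 \<rho> by (intro mult_mono) auto
  also have "\<dots> \<le> N ?S" using NT TS by simp
  finally show "(1 - \<gamma>) ^ 3 * ?F \<le> N ?S" by (simp add: power3_eq_cube mult.assoc)
  have "N ?T' \<le> (\<Sum>k\<in>K'. N (\<lambda>t. \<alpha> k * copy b a k t))"
    using sum_mem_norm[OF KK'(4), of "\<lambda>k t. \<alpha> k * copy b a k t"] yX by simp
  also have "\<dots> \<le> (\<Sum>k\<in>K'. \<eta> powr \<theta> * ?F)"
  proof (intro sum_mono)
    fix k assume k: "k \<in> K'"
    have "N (copy b a k) = ?F"
    proof (rule norm_eq_of_distribution(2)[OF window_mem[OF ab(1)] measurable[OF xX]])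
      fix \<tau> :: real assume \<tau>: "0 < \<tau>"
      have kn: "k \<in> {1..n}" using k by (simp add: K'_def)
      have "a \<le> 1" using copy_position[OF kn a ab(3)] by linarith
      then show "distribution_fun (copy b a k) \<tau> = distribution_fun (window g b a) \<tau>"
        using distribution_fun_copy[of b "real (k - 1) * a" a \<tau> 1] distribution_fun_window[of b a \<tau> 1]
          copy_position[OF kn a ab(3)] \<tau> ab by simp
    qed
    moreover have "\<bar>\<alpha> k\<bar> \<le> \<eta> powr \<theta>"
      unfolding s\<theta>[symmetric] using k s0[of k] \<theta>_pos by (intro powr_mono2) (auto simp: K'_def)
    ultimately show "N (\<lambda>t. \<alpha> k * copy b a k t) \<le> \<eta> powr \<theta> * ?F"
      using norm_scale[OF xX, of "\<alpha> k"] F0 by (simp add: mult_right_mono)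
  qed
  also have "\<dots> = (real (card K') * \<eta> powr \<theta>) * ?F" by simp
  also have "\<dots> \<le> \<gamma> * ?F"
  proof (rule mult_right_mono[OF _ F0])
    have "real (card K') * \<eta> powr \<theta> \<le> real n * \<eta> powr \<theta>" using cardK' by (intro mult_right_mono) auto
    also have "\<dots> \<le> \<gamma>" using small unfolding \<eta>_def .
    finally show "real (card K') * \<eta> powr \<theta> \<le> \<gamma>" .
  qed
  finally have NT': "N ?T' \<le> \<gamma> * ?F" .
  have "N ?S \<le> N ?T + N ?T'" unfolding split by (rule norm_triangle[OF TX TX'])
  also have "\<dots> \<le> (1 + \<gamma>) * ((1 + \<gamma>) * ?F) + \<gamma> * ?F"
  proof (rule add_mono[OF _ NT'])
    have "\<rho> * N ?R \<le> N ?R" using \<rho> norm_nonneg[OF RX] by (intro mult_left_le_one_le) auto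
    then show "N ?T \<le> (1 + \<gamma>) * ((1 + \<gamma>) * ?F)" using upR unfolding NT by linarith
  qed
  also have "\<dots> = ((1 + \<gamma>)\<^sup>2 + \<gamma>) * ?F" by (simp add: power2_eq_square algebra_simps)
  also have "\<dots> \<le> (1 + \<gamma>) ^ 3 * ?F"
  proof (rule mult_right_mono[OF _ F0])
    have "(1 + \<gamma>) ^ 3 = (1 + \<gamma>)\<^sup>2 + \<gamma> * (1 + \<gamma>)\<^sup>2" by (simp add: power3_eq_cube power2_eq_square algebra_simps)
    moreover have "\<gamma> * 1 \<le> \<gamma> * (1 + \<gamma>)\<^sup>2" using \<gamma> by (intro mult_left_mono) auto
    ultimately show "(1 + \<gamma>)\<^sup>2 + \<gamma> \<le> (1 + \<gamma>) ^ 3" by simp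
  qed
  finally show "N ?S \<le> (1 + \<gamma>) ^ 3 * ?F" .
qed

text \<open>The value of \<open>\<gamma>\<close> ensures \<open>(1 + \<gamma>) ^ 3 \<le> 1 + \<epsilon>\<close> and \<open>1 / (1 + \<epsilon>) \<le> (1 - \<gamma>) ^ 3\<close>.\<close>

lemma copies_symmetric_system:
  assumes ab: "0 < b" "b \<le> a" "real n * a \<le> 1" "2 ^ m * a \<le> 1"
    and n: "1 \<le> n" and \<epsilon>: "0 < \<epsilon>" and \<gamma>: "\<gamma> = min 1 \<epsilon> / 8" and \<theta>1: "\<theta> \<le> 1"
    and edge_a: "2 ^ m * (fundamental_fun N a * g a) \<le> \<gamma> * N (window g b a)"
    and edge_b: "2 ^ m * (fundamental_fun N b * g b) \<le> \<gamma> * N (window g b a)"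
    and small: "real n * (1 / 2 ^ m) powr \<theta> \<le> \<gamma>" and flat: "(2 ^ m) powr \<delta> \<le> 1 + \<gamma>"
  shows "\<exists>x. symmetric_system X n x \<and> lp_equivalent N (ereal (1 / \<theta>)) (1 + \<epsilon>) n x"
proof -
  let ?F = "N (window g b a)"
  have \<gamma>01: "0 < \<gamma>" "\<gamma> < 1" using \<epsilon> \<gamma> by auto
  have a: "0 < a" "a \<le> 1"
  proof -
    show "0 < a" using ab by simp
    then have "1 * a \<le> 2 ^ m * a" by (intro mult_right_mono) auto
    then show "a \<le> 1" using ab(4) by linarith
  qed
  have "0 < fundamental_fun N a * g a" using fundamental_fun_pos a g_pos by simp
  then have "0 < \<gamma> * ?F" using edge_a by (intro less_le_trans[OF _ edge_a]) simp
  then have F: "0 < ?F" using \<gamma>01 by (simp add: zero_less_mult_iff)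
  have "(1 + \<gamma>) ^ 3 = 1 + \<gamma> * (3 + 3 * \<gamma> + \<gamma>\<^sup>2)" by (simp add: power3_eq_cube power2_eq_square algebra_simps)
  also have "\<dots> \<le> 1 + \<gamma> * 8"
  proof -
    have "\<gamma>\<^sup>2 \<le> 1" using \<gamma>01 by (simp add: power_le_one)
    then show ?thesis using \<gamma>01 by (intro add_left_mono mult_left_mono) auto
  qed
  also have "\<dots> \<le> 1 + \<epsilon>" using \<gamma> by simp
  finally have up: "(1 + \<gamma>) ^ 3 \<le> 1 + \<epsilon>" .
  have "inverse (1 + \<epsilon>) \<le> 1 - 3 * \<gamma>"
  proof (cases "\<epsilon> \<le> 1")
    case True
    then have e8: "\<gamma> = \<epsilon> / 8" using \<gamma> by simp
    have "\<gamma> * \<epsilon> \<le> \<gamma> * 1" using True \<gamma>01 by (intro mult_left_mono) auto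
    moreover have "(1 - 3 * \<gamma>) * (1 + \<epsilon>) = 1 + \<epsilon> - 3 * \<gamma> - 3 * (\<gamma> * \<epsilon>)" by (simp add: algebra_simps)
    ultimately have "1 \<le> (1 - 3 * \<gamma>) * (1 + \<epsilon>)" using \<epsilon> e8 by linarith
    then show ?thesis using \<epsilon> by (simp add: inverse_eq_divide pos_divide_le_eq)
  next
    case False
    then have "inverse (1 + \<epsilon>) \<le> inverse 2" by (intro le_imp_inverse_le) auto
    moreover have "\<gamma> = 1 / 8" using False \<gamma> by simp
    ultimately show ?thesis by simp
  qed
  also have "\<dots> \<le> (1 - \<gamma>) ^ 3"
  proof -
    have "(1 - \<gamma>) ^ 3 = 1 - 3 * \<gamma> + \<gamma>\<^sup>2 * (3 - \<gamma>)" by algebra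
    moreover have "0 \<le> \<gamma>\<^sup>2 * (3 - \<gamma>)" using \<gamma>01 by simp
    ultimately show ?thesis by linarith
  qed
  finally have lo: "inverse (1 + \<epsilon>) \<le> (1 - \<gamma>) ^ 3" .
  define x where "x k = (\<lambda>t. 1 / ?F * copy b a k t)" for k
  have cX: "copy b a k \<in> X" for k by (rule copy_mem[OF ab(1)])
  have xX: "x k \<in> X" for k unfolding x_def by (rule scale_mem[OF cX])
  have "symmetric_system X n x"
    unfolding symmetric_system_def equimeasurable_def
  proof (intro conjI ballI allI impI)
    fix i j \<tau> assume ij: "i \<in> {1..n}" "j \<in> {1..n}" and \<tau>: "0 < (\<tau>::real)"
    have "distribution_fun (x k) \<tau> = measure lebesgue {t. b < t \<and> t \<le> a \<and> \<tau> < \<bar>1 / ?F\<bar> * g t}"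
      if "k \<in> {1..n}" for k
      unfolding x_def
      by (rule distribution_fun_copy[OF _ copy_position[OF that a(1) ab(3)]]) (use \<tau> ab(1) in simp_all)
    then show "distribution_fun (x i) \<tau> = distribution_fun (x j) \<tau>" using ij by (simp only:)
  next
    fix i j assume "i \<in> {1..n}" "j \<in> {1..n}" "i \<noteq> j"
    then have "copy b a i s = 0 \<or> copy b a j s = 0" for s
      using ab by (intro copy_disjoint) auto
    then show "AE s in unit_leb. x i s = 0 \<or> x j s = 0" by (intro AE_I2) (auto simp: x_def)
  qed (rule xX)
  moreover have "lp_equivalent N (ereal (1 / \<theta>)) (1 + \<epsilon>) n x"
    unfolding lp_equivalent_def
  proof (intro allI)
    fix \<alpha> :: "nat \<Rightarrow> real"
    let ?S = "\<lambda>t. \<Sum>k=1..n. \<alpha> k * x k t"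
    define L where "L = (\<Sum>k=1..n. \<bar>\<alpha> k\<bar> powr (1 / \<theta>))"
    have lp: "lp_norm (ereal (1 / \<theta>)) n \<alpha> = L powr \<theta>" by (simp add: lp_norm_def L_def)
    have L0: "0 \<le> L" unfolding L_def by (intro sum_nonneg) simp
    show "inverse (1 + \<epsilon>) * lp_norm (ereal (1 / \<theta>)) n \<alpha> \<le> N ?S \<and> N ?S \<le> (1 + \<epsilon>) * lp_norm (ereal (1 / \<theta>)) n \<alpha>"
    proof (cases "L = 0")
      case True
      then have "\<alpha> k = 0" if "k \<in> {1..n}" for k
        using that sum_nonneg_eq_0_iff[of "{1..n}" "\<lambda>k. \<bar>\<alpha> k\<bar> powr (1 / \<theta>)"] by (auto simp: L_def)
      then have "?S = (\<lambda>t. 0)" by (simp add: fun_eq_iff)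
      then show ?thesis using norm_eq_0_iff[OF zero_mem] lp True by simp
    next
      case False
      then have L: "0 < L" using L0 by simp
      define l where "l = L powr \<theta>"
      have l: "0 < l" using L by (simp add: l_def)
      let ?\<beta> = "\<lambda>k. \<alpha> k / l"
      let ?T = "\<lambda>t. \<Sum>k=1..n. ?\<beta> k * copy b a k t"
      have "\<bar>?\<beta> k\<bar> powr (1 / \<theta>) = \<bar>\<alpha> k\<bar> powr (1 / \<theta>) / L" for k
        using L l \<theta>_pos by (simp add: powr_divide l_def powr_powr)
      then have "(\<Sum>k=1..n. \<bar>?\<beta> k\<bar> powr (1 / \<theta>)) = 1"
        using L by (simp only: sum_divide_distrib[symmetric] L_def[symmetric]) simp
      note iso = copies_almost_isometric[OF ab \<gamma>01 \<theta>1 edge_a edge_b small flat this]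
      have TX: "?T \<in> X"
        using sum_mem_norm[of "{1..n}" "\<lambda>k t. ?\<beta> k * copy b a k t", OF finite_atLeastAtMost scale_mem[OF cX]]
        by (rule conjunct1)
      have "?S = (\<lambda>t. l / ?F * ?T t)"
      proof
        fix t
        have "\<alpha> k * x k t = l / ?F * (?\<beta> k * copy b a k t)" for k using l by (simp add: x_def)
        then show "?S t = l / ?F * ?T t" unfolding sum_distrib_left by (rule sum.cong[OF refl])
      qed
      then have NS: "N ?S = l / ?F * N ?T" using norm_scale[OF TX, of "l / ?F"] l F by simp
      have F0: "0 \<le> ?F" using F by simp
      have "inverse (1 + \<epsilon>) * ?F \<le> N ?T" by (rule order_trans[OF mult_right_mono[OF lo F0] iso(1)])
      then have "l / ?F * (inverse (1 + \<epsilon>) * ?F) \<le> N ?S" unfolding NS using l F by (intro mult_left_mono) auto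
      moreover have "N ?T \<le> (1 + \<epsilon>) * ?F" by (rule order_trans[OF iso(2) mult_right_mono[OF up F0]])
      then have "N ?S \<le> l / ?F * ((1 + \<epsilon>) * ?F)" unfolding NS using l F by (intro mult_left_mono) auto
      ultimately show ?thesis using F by (simp add: lp l_def mult.commute)
    qed
  qed
  ultimately show ?thesis by blast
qed

text \<open>A single dyadic piece of the window already has a large norm: it has length \<open>1 / 2 ^ j\<close> and
  left end \<open>1 / 2 ^ j\<close>, and the profile loses at most a factor of \<open>4\<close> on it.\<close>

lemma dyadic_window_norm:
  assumes A: "A < j" and B: "j \<le> B" and \<theta>\<delta>: "\<theta> + \<delta> \<le> 2"
  shows "fundamental_fun N (1 / 2 ^ j) * g (1 / 2 ^ j) \<le> 4 * N (window g (1 / 2 ^ B) (1 / 2 ^ A))"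
proof -
  let ?r = "1 / 2 ^ j :: real"
  let ?I = "{?r<..2 * ?r}"
  let ?f = "window g (1 / 2 ^ B) (1 / 2 ^ A)"
  have r: "0 < ?r" "1 / 2 ^ B \<le> ?r" using B by (auto simp: frac_le)
  have "(2::real) ^ Suc A \<le> 2 ^ j" using A by (intro power_increasing) auto
  then have r2: "2 * ?r \<le> 1 / 2 ^ A" by (simp add: field_simps)
  also have "1 / 2 ^ A \<le> (1::real)" by simp
  finally have r1: "2 * ?r \<le> 1" .
  have I01: "?I \<subseteq> {0..1}"
  proof
    fix s assume "s \<in> ?I"
    then have "?r < s" "s \<le> 2 * ?r" by auto
    then show "s \<in> {0..1}" using r(1) r1 unfolding atLeastAtMost_iff by linarith
  qed
  have Im: "?I \<in> sets unit_leb"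
  proof -
    have "{0..1} \<inter> ?I = ?I" using I01 by (rule Int_absorb1)
    then show ?thesis by (metis (no_types) greaterThanAtMost_borel image_eqI sets_completionI_sets sets_lborel sets_restrict_space)
  qed
  have "measure unit_leb ?I = measure lebesgue ?I" by (rule measure_restrict_space[OF _ I01]) simp
  then have "measure unit_leb ?I = ?r" using r by simp
  then have NI: "N (indicator ?I) = fundamental_fun N ?r" by (rule fundamental_fun_eq[OF Im])
  have IX: "indicator ?I \<in> X" by (rule indicator_mem[OF Im])
  have "(1 / 2) powr 2 \<le> (1 / 2 :: real) powr (\<theta> + \<delta>)" using \<theta>\<delta> by (intro powr_mono') auto
  then have "1 / 4 * g ?r \<le> (1 / 2) powr (\<theta> + \<delta>) * g ?r"
    using g_pos[OF r(1)] by (intro mult_right_mono) (auto simp: powr_numeral power2_eq_square)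
  also have "\<dots> \<le> g (2 * ?r)" using g_lower[OF r(1), of "1 / 2"] by (simp add: mult.commute)
  finally have q: "1 / 4 * g ?r \<le> g (2 * ?r)" .
  have fX: "?f \<in> X" by (rule window_mem) simp
  have "N (\<lambda>s. 1 / 4 * g ?r * indicator ?I s) \<le> N ?f"
  proof (rule norm_mono(2)[OF fX measurable[OF scale_mem[OF IX]]])
    fix s :: real
    have "1 / 4 * g ?r \<le> \<bar>?f s\<bar>" if "s \<in> ?I"
    proof -
      have s: "0 < s" "s \<le> 2 * ?r" "1 / 2 ^ B < s" "s \<le> 1 / 2 ^ A" using that r r2 by auto
      then show ?thesis using q g_antimono[OF s(1,2)] g_pos[OF s(1)] by (simp add: window_def)
    qed
    then show "\<bar>1 / 4 * g ?r * indicator ?I s\<bar> \<le> \<bar>?f s\<bar>"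
      using g_pos[OF r(1)] by (cases "s \<in> ?I") simp_all
  qed
  moreover have "N (\<lambda>s. 1 / 4 * g ?r * indicator ?I s) = 1 / 4 * g ?r * fundamental_fun N ?r"
    unfolding norm_scale[OF IX] NI using g_pos[OF r(1)] by simp
  ultimately show ?thesis by (simp add: mult.commute)
qed

end

section \<open>Sufficiency of the index bounds\<close>

text \<open>The power \<open>t powr (- \<theta>)\<close>, made flatter by the exponent \<open>\<delta>\<close> to the left of \<open>c\<close> and steeper
  by \<open>\<delta>\<close> to the right of \<open>c\<close>.\<close>

definition bent_power :: "real \<Rightarrow> real \<Rightarrow> real \<Rightarrow> real \<Rightarrow> real" where
  "bent_power \<theta> \<delta> c t = min (c powr (- \<delta>) * t powr (\<delta> - \<theta>)) (c powr \<delta> * t powr (- \<delta> - \<theta>))"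

lemma (in ri_space) bent_power_almost_homogeneous:
  assumes \<delta>: "0 \<le> \<delta>" "\<delta> \<le> \<theta>" and \<theta>: "0 < \<theta>" and c: "0 < c"
  shows "almost_homogeneous X N (bent_power \<theta> \<delta> c) \<theta> \<delta>"
proof unfold_locales
  show "bent_power \<theta> \<delta> c \<in> borel_measurable borel" unfolding bent_power_def by measurable
  show "0 < bent_power \<theta> \<delta> c t" if "0 < t" for t using c that by (simp add: bent_power_def)
  show "bent_power \<theta> \<delta> c t \<le> bent_power \<theta> \<delta> c s" if "0 < s" "s \<le> t" for s t
    unfolding bent_power_def using that \<delta> by (intro min.mono mult_left_mono powr_mono2') auto
  fix s t :: real assume st: "0 < t" "0 < s" "s \<le> 1"
  have div: "(t / s) powr (- e) = s powr e * t powr (- e)" for e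
    using st by (simp add: powr_divide powr_minus field_simps)
  have eq: "bent_power \<theta> \<delta> c (t / s) = min (s powr (\<theta> - \<delta>) * (c powr (- \<delta>) * t powr (\<delta> - \<theta>)))
      (s powr (\<theta> + \<delta>) * (c powr \<delta> * t powr (- \<delta> - \<theta>)))"
  proof -
    have "(t / s) powr (\<delta> - \<theta>) = s powr (\<theta> - \<delta>) * t powr (\<delta> - \<theta>)"
      using div[of "\<theta> - \<delta>"] by simp
    moreover have "(t / s) powr (- \<delta> - \<theta>) = s powr (\<theta> + \<delta>) * t powr (- \<delta> - \<theta>)"
      using div[of "\<delta> + \<theta>"] by (simp add: add.commute)
    ultimately show ?thesis by (simp add: bent_power_def mult_ac)
  qed
  have le: "s powr (\<theta> + \<delta>) \<le> s powr (\<theta> - \<delta>)" using st \<delta> by (intro powr_mono') auto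
  show "s powr (\<theta> + \<delta>) * bent_power \<theta> \<delta> c t \<le> bent_power \<theta> \<delta> c (t / s)"
    unfolding eq using le by (auto simp: bent_power_def intro!: mult_mono)
  have "bent_power \<theta> \<delta> c (t / s) \<le> min (s powr (\<theta> - \<delta>) * (c powr (- \<delta>) * t powr (\<delta> - \<theta>)))
      (s powr (\<theta> - \<delta>) * (c powr \<delta> * t powr (- \<delta> - \<theta>)))"
    unfolding eq using le by (intro min.mono mult_right_mono) auto
  then show "bent_power \<theta> \<delta> c (t / s) \<le> s powr (\<theta> - \<delta>) * bent_power \<theta> \<delta> c t"
    by (simp add: bent_power_def min_mult_distrib_left)
qed (use \<delta> \<theta> in auto)

lemma bent_power_dyadic:
  fixes J i :: nat
  assumes "0 \<le> \<delta>"
  shows "bent_power \<theta> \<delta> (1 / 2 ^ J) (1 / 2 ^ i) = min (2 powr (\<delta> * real J) * 2 powr ((\<theta> - \<delta>) * real i))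
    (2 powr (- \<delta> * real J) * 2 powr ((\<theta> + \<delta>) * real i))"
proof -
  have "(1 / 2 ^ k) powr e = 2 powr (- e * real k)" for k :: nat and e :: real
  proof -
    have "1 / 2 ^ k = 2 powr (- real k)" by (simp add: powr_minus powr_realpow field_simps)
    then show ?thesis by (simp add: powr_powr mult.commute)
  qed
  then show ?thesis by (simp add: bent_power_def algebra_simps)
qed

text \<open>Moving towards \<open>0\<close>, the product of the fundamental function with \<open>t powr (- \<theta>)\<close> hardly
  decreases along a stretch of slow decay, and hardly increases along a stretch of fast decay. The
  bend of the profile between two such stretches turns this into exponential growth along the
  first one and exponential decrease along the second one. At both ends of the window that spans
  the two stretches the product is therefore negligible against the norm of the windowed
  profile.\<close>

lemma (in ri_space) sym_fin_rep_finite_exponent: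
  assumes \<theta>: "0 < \<theta>" "\<theta> \<le> 1"
    and low: "lower_dilation_index (fundamental_fun N) \<le> \<theta>"
    and up: "\<theta> \<le> upper_dilation_index (fundamental_fun N)"
  shows "sym_fin_rep X N (ereal (1 / \<theta>))"
  unfolding sym_fin_rep_def
proof (intro allI impI)
  fix n :: nat and \<epsilon> :: real assume n: "1 \<le> n" and \<epsilon>: "0 < \<epsilon>"
  define \<gamma> where "\<gamma> = min 1 \<epsilon> / 8"
  have \<gamma>: "0 < \<gamma>" using \<epsilon> by (simp add: \<gamma>_def)
  \<comment> \<open>Coefficients with \<open>\<bar>a k\<bar> powr (1 / \<theta>) < 1 / 2 ^ m\<close> are to be negligible.\<close>
  obtain m :: nat where m: "log 2 (real n / \<gamma>) / \<theta> < real m" using reals_Archimedean2 by blast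
  have small: "real n * (1 / 2 ^ m) powr \<theta> \<le> \<gamma>"
  proof -
    have "log 2 (real n / \<gamma>) \<le> real m * \<theta>" using m \<theta> by (simp add: field_simps)
    then have "real n / \<gamma> \<le> 2 powr (real m * \<theta>)" using n \<gamma> by (simp add: log_le_iff)
    moreover have "(2 ^ m) powr \<theta> = 2 powr (real m * \<theta>)" by (simp add: powr_powr powr_realpow[symmetric])
    ultimately show ?thesis using \<gamma> by (simp add: powr_divide field_simps)
  qed
  \<comment> \<open>The deviation from a power function is to be negligible for contractions down to \<open>1 / 2 ^ m\<close>.\<close>
  define \<delta> where "\<delta> = min \<theta> (log 2 (1 + \<gamma>) / (real m + 1))"
  have "0 < log 2 (1 + \<gamma>)" using \<gamma> by simp
  then have \<delta>: "0 < \<delta>" "\<delta> \<le> \<theta>" using \<theta> by (auto simp: \<delta>_def)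
  have flat: "(2 ^ m) powr \<delta> \<le> 1 + \<gamma>"
  proof -
    have "real m * \<delta> \<le> (real m + 1) * \<delta>" using \<delta> by (simp add: mult_right_mono)
    also have "\<dots> \<le> (real m + 1) * (log 2 (1 + \<gamma>) / (real m + 1))"
      by (intro mult_left_mono) (auto simp: \<delta>_def)
    finally have "real m * \<delta> \<le> log 2 (1 + \<gamma>)" by simp
    then have "2 powr (real m * \<delta>) \<le> 1 + \<gamma>" using \<gamma> by (simp add: le_log_iff)
    then show ?thesis by (simp add: powr_powr powr_realpow[symmetric])
  qed
  \<comment> \<open>An edge strip costs a factor \<open>2 ^ m\<close>, and the bound from a dyadic piece a factor \<open>4\<close>.\<close>
  define e where "e = \<gamma> / 2 ^ m / 4"
  have e: "0 < e" using \<gamma> by (simp add: e_def)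
  let ?w = "\<lambda>i. fundamental_fun N (1 / 2 ^ i)"
  have doubling: "?w i \<le> 2 ^ j * ?w (i + j)" for i j :: nat
  proof -
    have "1 / 2 ^ (i + j) \<le> min 1 (1 / (2::real) ^ j)" by (auto simp: power_add field_simps)
    from fundamental_fun_grow[OF _ this] show ?thesis by (simp add: power_add)
  qed
  have dec: "?w j \<le> ?w i" if "i \<le> j" for i j
    using that by (intro fundamental_fun_mono) (auto simp: frac_le)
  have pos: "0 < ?w i" for i by (rule fundamental_fun_pos) auto
  obtain A J K B where AB: "n + m \<le> A" "A < J" "J \<le> K" "K < B"
    and wA: "?w A * 2 powr ((\<theta> + \<delta>) * real A) \<le> e * (?w J * 2 powr ((\<theta> + \<delta>) * real J))"
    and wB: "?w B * 2 powr ((\<theta> - \<delta>) * real B) \<le> e * (?w K * 2 powr ((\<theta> - \<delta>) * real K))"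
    using separating_windows[where w="?w" and P="n + m", OF pos dec doubling
        lower_dilation_window[OF low] upper_dilation_window[OF up] \<delta>(1) e] by blast
  let ?g = "bent_power \<theta> \<delta> (1 / 2 ^ J)"
  interpret G: almost_homogeneous X N ?g \<theta> \<delta>
    by (rule bent_power_almost_homogeneous) (use \<delta> \<theta> in auto)
  let ?a = "1 / 2 ^ A :: real" and ?b = "1 / 2 ^ B :: real"
  let ?F = "N (window ?g ?b ?a)"
  note dy = bent_power_dyadic[of \<delta> \<theta>]
  have gJ: "?g (1 / 2 ^ J) = 2 powr (- \<delta> * real J) * 2 powr ((\<theta> + \<delta>) * real J)"
    using \<delta> by (simp add: dy powr_add[symmetric] algebra_simps)
  have gK: "?g (1 / 2 ^ K) = 2 powr (\<delta> * real J) * 2 powr ((\<theta> - \<delta>) * real K)"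
  proof -
    have "\<delta> * real J \<le> \<delta> * real K" using \<delta> AB by simp
    then show ?thesis using \<delta> by (simp add: dy powr_add[symmetric] algebra_simps)
  qed
  have "?w A * ?g ?a \<le> ?w A * (2 powr (- \<delta> * real J) * 2 powr ((\<theta> + \<delta>) * real A))"
    using \<delta> pos[of A] by (intro mult_left_mono) (auto simp: dy)
  also have "\<dots> = 2 powr (- \<delta> * real J) * (?w A * 2 powr ((\<theta> + \<delta>) * real A))" by (simp only: mult_ac)
  also have "\<dots> \<le> 2 powr (- \<delta> * real J) * (e * (?w J * 2 powr ((\<theta> + \<delta>) * real J)))"
    by (intro mult_left_mono wA) simp
  also have "\<dots> = e * (?w J * ?g (1 / 2 ^ J))" unfolding gJ by (simp only: mult_ac)
  also have "\<dots> \<le> e * (4 * ?F)"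
    using G.dyadic_window_norm[of A J B] AB \<delta> \<theta> e by (intro mult_left_mono) auto
  finally have edge_a: "2 ^ m * (?w A * ?g ?a) \<le> \<gamma> * ?F" by (simp add: e_def field_simps)
  have "?w B * ?g ?b \<le> ?w B * (2 powr (\<delta> * real J) * 2 powr ((\<theta> - \<delta>) * real B))"
    using \<delta> pos[of B] by (intro mult_left_mono) (auto simp: dy)
  also have "\<dots> = 2 powr (\<delta> * real J) * (?w B * 2 powr ((\<theta> - \<delta>) * real B))" by (simp only: mult_ac)
  also have "\<dots> \<le> 2 powr (\<delta> * real J) * (e * (?w K * 2 powr ((\<theta> - \<delta>) * real K)))"
    by (intro mult_left_mono wB) simp
  also have "\<dots> = e * (?w K * ?g (1 / 2 ^ K))" unfolding gK by (simp only: mult_ac)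
  also have "\<dots> \<le> e * (4 * ?F)"
    using G.dyadic_window_norm[of A K B] AB \<delta> \<theta> e by (intro mult_left_mono) auto
  finally have edge_b: "2 ^ m * (?w B * ?g ?b) \<le> \<gamma> * ?F" by (simp add: e_def field_simps)
  have "?b \<le> ?a" using AB by (intro frac_le power_increasing) auto
  moreover have "real n * ?a \<le> 1"
  proof -
    have "real n < 2 ^ n" by (rule of_nat_less_two_power)
    also have "\<dots> \<le> (2::real) ^ A" using AB by (intro power_increasing) auto
    finally show ?thesis by simp
  qed
  moreover have "2 ^ m * ?a \<le> 1"
  proof -
    have "(2::real) ^ m \<le> 2 ^ A" using AB by (intro power_increasing) auto
    then show ?thesis by simp
  qed
  ultimately show "\<exists>x. symmetric_system X n x \<and> lp_equivalent N (ereal (1 / \<theta>)) (1 + \<epsilon>) n x"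
    by (intro G.copies_symmetric_system[OF _ _ _ _ n \<epsilon> \<gamma>_def \<theta>(2) edge_a edge_b small flat]) auto
qed

lemma sym_fin_rep_imp_crude: "sym_fin_rep X N p \<Longrightarrow> crude_sym_fin_rep X N p"
  unfolding sym_fin_rep_def crude_sym_fin_rep_def
proof (rule exI[where x="1 + 1"], intro conjI allI impI)
  fix n :: nat
  assume "\<forall>n\<ge>1. \<forall>\<epsilon>>0. \<exists>x. symmetric_system X n x \<and> lp_equivalent N p (1 + \<epsilon>) n x" "1 \<le> n"
  then show "\<exists>x. symmetric_system X n x \<and> lp_equivalent N p (1 + 1) n x" using zero_less_one by blast
qed simp

lemma mem_reciprocal_interval_iff:
  fixes \<alpha> \<beta> :: real
  assumes "0 \<le> \<alpha>" "0 \<le> \<beta>" "1 \<le> p"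
  shows "p \<in> {1 / ereal \<beta> .. 1 / ereal \<alpha>} \<longleftrightarrow> \<alpha> \<le> inv_exponent p \<and> inv_exponent p \<le> \<beta>"
proof -
  have "1 / ereal c = (if c = 0 then \<infinity> else ereal (1 / c))" if "0 \<le> c" for c
    by (simp add: divide_ereal_def inverse_eq_divide)
  note r = this[OF assms(1)] this[OF assms(2)]
  show ?thesis
  proof (cases p)
    case (real q)
    then have "1 \<le> q" using assms(3) by simp
    then show ?thesis using real assms(1,2) unfolding r inv_exponent_def by (auto simp: field_simps)
  next
    case PInf
    then show ?thesis using assms(1,2) unfolding r inv_exponent_def by auto
  qed (use assms(3) in simp)
qed

theorem theorem2:
  fixes X :: "(real \<Rightarrow> real) set" and N :: "(real \<Rightarrow> real) \<Rightarrow> real"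
  assumes "ri_space X N"
    and "norm_separable X N"
    and "fundamental_type X N"
  shows "sym_fin_rep_set X N = crude_sym_fin_rep_set X N \<and>
    crude_sym_fin_rep_set X N = {1 / ereal (upper_boyd X N) .. 1 / ereal (lower_boyd X N)}"
proof -
  interpret ri_space X N by (rule assms(1))
  let ?I = "{1 / ereal (upper_boyd X N) .. 1 / ereal (lower_boyd X N)}"
  have iff: "p \<in> ?I \<longleftrightarrow> lower_boyd X N \<le> inv_exponent p \<and> inv_exponent p \<le> upper_boyd X N" if "1 \<le> p" for p
    using mem_reciprocal_interval_iff[OF boyd_bounds(1,2) that] .
  have "sym_fin_rep_set X N \<subseteq> crude_sym_fin_rep_set X N"
    by (auto simp: sym_fin_rep_set_def crude_sym_fin_rep_set_def sym_fin_rep_imp_crude)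
  moreover have "crude_sym_fin_rep_set X N \<subseteq> ?I"
    using iff crude_sym_fin_rep_boyd by (auto simp only: crude_sym_fin_rep_set_def mem_Collect_eq)
  moreover have "?I \<subseteq> sym_fin_rep_set X N"
  proof
    fix p assume p: "p \<in> ?I"
    have "1 \<le> 1 / ereal (upper_boyd X N)"
      using boyd_bounds(2,3) by (cases "upper_boyd X N = 0") (auto simp: divide_ereal_def one_ereal_def field_simps)
    then have p1: "1 \<le> p" using p by auto
    then have bounds: "lower_boyd X N \<le> inv_exponent p" "inv_exponent p \<le> upper_boyd X N"
      using p iff by auto
    have "sym_fin_rep X N p"
    proof (cases p)
      case (real q)
      then have q: "1 \<le> q" "inv_exponent p = 1 / q" using p1 by (auto simp: inv_exponent_def)
      then have "sym_fin_rep X N (ereal (1 / (1 / q)))"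
        using bounds assms(3) by (intro sym_fin_rep_finite_exponent) (auto simp: fundamental_type_def)
      then show ?thesis using real by simp
    next
      case PInf
      then have "lower_boyd X N = 0" using bounds boyd_bounds(1) by (simp add: inv_exponent_def)
      then show ?thesis using sym_fin_rep_infinity PInf by simp
    qed (use p1 in simp)
    then show "p \<in> sym_fin_rep_set X N" using p1 by (simp add: sym_fin_rep_set_def)
  qed
  ultimately show ?thesis by blast
qed

end
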